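(* Let $n\ge 1$, let $V$ be the conjugacy class of $s_1$ in the $n$-qubit projective Clifford group $\mathcal{C}_n$, and for $g\in\mathcal{C}_n$ let $\sigma_g$ denote the permutation of $V$ induced by conjugation by $g$, i.e. $\sigma_g: v\mapsto g^{-1}vg$. Then the map $\mathcal{C}_n\to \mathrm{Sym}_{|V|}$, $g\mapsto\sigma_g$, is a faithful (i.e. injective) homomorphism. Moreover, $|V| = 2(4^n-1)$.
   Context: Let $\omega$ be a primitive 8th root of unity and $Z=\begin{bmatrix}1&0\\0&-1\end{bmatrix}$, $X=\begin{bmatrix}0&1\\1&0\end{bmatrix}$, $H=\frac1{\sqrt2}\begin{bmatrix}1&1\\1&-1\end{bmatrix}$, $S=\begin{bmatrix}1&0\\0&\omega^2\end{bmatrix}$, $CZ=\mathrm{diag}(1,1,1,-1)$. For $U\in\{Z,X,H,S\}$ put $U_i=I_2^{\otimes(i-1)}\otimes U\otimes I_2^{\otimes(n-i)}$, and put $CZ_{i\to i+1}=I_2^{\otimes(i-1)}\otimes CZ\otimes I_2^{\otimes(n-i-1)}$ for $1\le i\le n-1$. The $n$-qubit Pauli group $\mathrm{Pauli}_n$ is the group generated by all $X_i$, $Z_i$ and $\omega^2 I_2^{\otimes n}$. The $n$-qubit Clifford group $\mathrm{Cliff}_n$ is the normalizer of $\mathrm{Pauli}_n$ in the unitary group $U(2^n)$ with global phases restricted to powers of $\omega$; it is the finite group generated by $\omega I_2^{\otimes n}$, all $H_i$, all $S_i$ and all $CZ_{i\to i+1}$. The $n$-qubit projective Clifford group is $\mathcal{C}_n=\mathrm{Cliff}_n/\langle\omega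 I_2^{\otimes n}\rangle$ (equivalently the normalizer of $\mathrm{Pauli}_n$ in $U(2^n)$ modulo all scalars). Write $h_i,s_i,\Lambda_i$ for the classes of $H_i,S_i,CZ_{i\to i+1}$ in $\mathcal{C}_n$; they generate $\mathcal{C}_n$. Convention: products in $\mathcal{C}_n$ are written from left to right (circuit order), i.e. the opposite of matrix multiplication: $[U][V]=[VU]$; permutations are likewise composed from left to right. $\mathrm{Sym}_{|V|}$ is identified with the symmetric group on the set $V$. *)

theory Defs
  imports
    "HOL-Algebra.Coset"
    "HOL-Algebra.Bij"
    "HOL-Algebra.Generated_Groups"
    "HOL-Algebra.Elementary_Groups"
    "Jordan_Normal_Form.Schur_Decomposition"
begin

section \<open>Groups: circuit order and conjugation\<close>

text \<open>
  The opposite monoid, used to compose from left to right: in the opposite of a group of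
  matrices \<open>U \<otimes> V\<close> is the matrix product \<open>V * U\<close>, and in the opposite of a group of
  permutations \<open>f \<otimes> g\<close> applies \<open>f\<close> first.
\<close>

definition opposite :: "('a, 'b) monoid_scheme \<Rightarrow> ('a, 'b) monoid_scheme" where
  "opposite G = G\<lparr>monoid.mult := (\<lambda>x y. y \<otimes>\<^bsub>G\<^esub> x)\<rparr>"

definition symmetric_group :: "'a set \<Rightarrow> ('a \<Rightarrow> 'a) monoid" where
  "symmetric_group V = opposite (BijGroup V)"

definition conjugate_by :: "('a, 'b) monoid_scheme \<Rightarrow> 'a \<Rightarrow> 'a \<Rightarrow> 'a" where
  "conjugate_by G g v = inv\<^bsub>G\<^esub> g \<otimes>\<^bsub>G\<^esub> v \<otimes>\<^bsub>G\<^esub> g"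

definition conjugacy_class :: "('a, 'b) monoid_scheme \<Rightarrow> 'a \<Rightarrow> 'a set" where
  "conjugacy_class G a = {conjugate_by G g a | g. g \<in> carrier G}"

text \<open>Elements of \<^const>\<open>Bij\<close> are undefined outside the set, whence the restriction.\<close>

definition conjugation_perm :: "('a, 'b) monoid_scheme \<Rightarrow> 'a set \<Rightarrow> 'a \<Rightarrow> 'a \<Rightarrow> 'a" where
  "conjugation_perm G V g = (\<lambda>v\<in>V. conjugate_by G g v)"

section \<open>Matrices\<close>

definition primitive_root_of_unity :: "nat \<Rightarrow> complex \<Rightarrow> bool" where
  "primitive_root_of_unity k z \<longleftrightarrow> z ^ k = 1 \<and> (\<forall>j. 0 < j \<and> j < k \<longrightarrow> z ^ j \<noteq> 1)"

definition kron :: "complex mat \<Rightarrow> complex mat \<Rightarrow> complex mat" (infixl "\<otimes>\<^sub>K" 70) where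
  "A \<otimes>\<^sub>K B = mat (dim_row A * dim_row B) (dim_col A * dim_col B)
     (\<lambda>(i, j). A $$ (i div dim_row B, j div dim_col B) * B $$ (i mod dim_row B, j mod dim_col B))"

definition unitary_group :: "nat \<Rightarrow> complex mat monoid" where
  "unitary_group N =
     \<lparr>carrier = {U \<in> carrier_mat N N. U * mat_adjoint U = 1\<^sub>m N \<and> mat_adjoint U * U = 1\<^sub>m N},
      monoid.mult = (*),
      one = 1\<^sub>m N\<rparr>"

definition gate_H :: "complex mat" where
  "gate_H = (1 / complex_of_real (sqrt 2)) \<cdot>\<^sub>m mat_of_rows_list 2 [[1, 1], [1, -1]]"

definition gate_S :: "complex \<Rightarrow> complex mat" where
  "gate_S \<omega> = mat_of_rows_list 2 [[1, 0], [0, \<omega>\<^sup>2]]"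

definition gate_CZ :: "complex mat" where
  "gate_CZ = mat_of_rows_list 4 [[1, 0, 0, 0], [0, 1, 0, 0], [0, 0, 1, 0], [0, 0, 0, -1]]"

text \<open>
  Qubits are numbered from 1 to \<open>n\<close>; the \<open>k\<close>-fold tensor power of the identity matrix of
  size 2 is written \<open>1\<^sub>m (2 ^ k)\<close>. The matrix \<open>on_qubits n i U\<close> acts as \<open>U\<close> on qubits \<open>i\<close> and
  \<open>i + 1\<close> and is meant for \<open>1 \<le> i \<le> n - 1\<close>.
\<close>

definition on_qubit :: "nat \<Rightarrow> nat \<Rightarrow> complex mat \<Rightarrow> complex mat" where
  "on_qubit n i U = 1\<^sub>m (2 ^ (i - 1)) \<otimes>\<^sub>K U \<otimes>\<^sub>K 1\<^sub>m (2 ^ (n - i))"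

definition on_qubits :: "nat \<Rightarrow> nat \<Rightarrow> complex mat \<Rightarrow> complex mat" where
  "on_qubits n i U = 1\<^sub>m (2 ^ (i - 1)) \<otimes>\<^sub>K U \<otimes>\<^sub>K 1\<^sub>m (2 ^ (n - i - 1))"

section \<open>The Clifford groups\<close>

definition clifford_gens :: "complex \<Rightarrow> nat \<Rightarrow> complex mat set" where
  "clifford_gens \<omega> n =
     {\<omega> \<cdot>\<^sub>m 1\<^sub>m (2 ^ n)}
     \<union> {on_qubit n i gate_H | i. 1 \<le> i \<and> i \<le> n}
     \<union> {on_qubit n i (gate_S \<omega>) | i. 1 \<le> i \<and> i \<le> n}
     \<union> {on_qubits n i gate_CZ | i. 1 \<le> i \<and> i + 1 \<le> n}"

text \<open>
  The normalizer of the Pauli group in the unitary group contains all scalars of modulus 1.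
  Restricting global phases to powers of \<open>\<omega>\<close> gives the finite subgroup generated by the
  following elements, and this is how the Clifford group is defined here. Products are in
  circuit order.
\<close>

definition clifford :: "complex \<Rightarrow> nat \<Rightarrow> complex mat monoid" where
  "clifford \<omega> n = subgroup_generated (opposite (unitary_group (2 ^ n))) (clifford_gens \<omega> n)"

definition phases :: "complex \<Rightarrow> nat \<Rightarrow> complex mat set" where
  "phases \<omega> n = generate (clifford \<omega> n) {\<omega> \<cdot>\<^sub>m 1\<^sub>m (2 ^ n)}"

definition proj_clifford :: "complex \<Rightarrow> nat \<Rightarrow> complex mat set monoid" where
  "proj_clifford \<omega> n = clifford \<omega> n Mod phases \<omega> n"

definition proj_class :: "complex \<Rightarrow> nat \<Rightarrow> complex mat \<Rightarrow> complex mat set" where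
  "proj_class \<omega> n U = phases \<omega> n #>\<^bsub>clifford \<omega> n\<^esub> U"

definition s_class :: "complex \<Rightarrow> nat \<Rightarrow> nat \<Rightarrow> complex mat set" where
  "s_class \<omega> n i = proj_class \<omega> n (on_qubit n i (gate_S \<omega>))"

end

theory Submission
  imports Defs
begin

text \<open>
  Write \<open>i\<close> for \<open>\<omega>\<^sup>2\<close>, a square root of \<open>-1\<close>. The phase gate is a linear combination of the identity
  and a Pauli matrix, \<open>S = (1 + i)/2 + (1 - i)/2 Z\<close>. Conjugating \<open>S\<close> on the first qubit by a
  Clifford \<open>U\<close> therefore gives the same combination with \<open>P = U Z\<^sub>1 U\<^sup>*\<close> in place of \<open>Z\<close>, and the
  whole theorem is a statement about how Cliffords act on signed Pauli strings \<open>\<plusminus>P\<close> other than the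
  identity, of which there are \<open>2 (4\<^sup>n - 1)\<close>.

  Every generator maps this set of signed strings into itself, hence so does every Clifford
  (\<open>clifford_maps_signed_paulis\<close>), and the action is transitive (\<open>clifford_transitive\<close>): \<open>H\<close> and
  \<open>S\<close> move any single-qubit Pauli to any other and flip signs, while \<open>CZ\<close> creates and erases
  tensor factors next to a factor \<open>X\<close>. So the conjugacy class of \<open>S\<^sub>1\<close> in the Clifford group
  is the set of all \<open>(1 + i)/2 + (1 - i)/2 P\<close> (\<open>conjugacy_class_phase_gate\<close>). Passing to the
  projective group identifies no two of them: all have the same trace \<open>2\<^sup>n (1 + i)/2\<close>, and it is
  nonzero, so two of them that agree up to a scalar are equal (\<open>rotation_phase_eqD\<close>). This gives the
  cardinality.

  For faithfulness, let the class of \<open>U\<close> act trivially. By the same trace argument, \<open>U\<close> commutes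
  on the nose, and not merely up to phase, with each element of the class, hence with each
  Pauli string. Averaging \<open>P U P\<close> over all Pauli strings \<open>P\<close> yields a multiple of the identity
  (\<open>pauli_twirl\<close>), so \<open>U\<close> is a scalar \<open>c\<close>. It remains to see that \<open>c\<close> is a power of \<open>\<omega>\<close>, and this
  is arithmetic: all gates have entries in \<open>\<int>[\<omega>, 1/2]\<close>, and the elements of that ring of modulus 1 are
  exactly the powers of \<open>\<omega>\<close> (\<open>unit_modulus_in_gate_ring\<close>). Writing
  \<open>2\<^sup>k c = a + b \<omega> + c' \<omega>\<^sup>2 + d \<omega>\<^sup>3\<close>, the equation \<open>c cnj c = 1\<close> splits, by the irrationality of
  \<open>\<surd>2\<close>, into \<open>a\<^sup>2 + b\<^sup>2 + c'\<^sup>2 + d\<^sup>2 = 4\<^sup>k\<close> and an orthogonality relation, and a descent modulo 4 removes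
  the denominator.
\<close>

section \<open>Kronecker products, adjoints and traces\<close>

text \<open>
  The Kronecker product indexes pairs by quotient and remainder; this turns a sum over such
  composite indices into a double sum, for matrix products and traces alike.
\<close>

lemma sum_div_mod:
  fixes f :: "nat \<Rightarrow> nat \<Rightarrow> 'a :: comm_monoid_add"
  shows "(\<Sum>k<a * b. f (k div b) (k mod b)) = (\<Sum>i<a. \<Sum>j<b. f i j)"
proof -
  have "(\<Sum>k<a * b. f (k div b) (k mod b)) = (\<Sum>i<a. \<Sum>k = i * b..<i * b + b. f (k div b) (k mod b))"
    by (rule sum.nat_group [symmetric])
  also have "\<dots> = (\<Sum>i<a. \<Sum>j<b. f i j)"
  proof (rule sum.cong [OF refl])
    fix i
    have "(\<Sum>k = i * b..<i * b + b. f (k div b) (k mod b))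
        = (\<Sum>j = 0..<b. f ((j + i * b) div b) ((j + i * b) mod b))"
      using sum.shift_bounds_nat_ivl [of "\<lambda>k. f (k div b) (k mod b)" 0 "i * b" b]
      by (simp add: add.commute)
    also have "\<dots> = (\<Sum>j<b. f i j)"
      by (rule sum.cong) auto
    finally show "(\<Sum>k = i * b..<i * b + b. f (k div b) (k mod b)) = (\<Sum>j<b. f i j)" .
  qed
  finally show ?thesis .
qed

lemma div_mod_bound:
  fixes i a b :: nat
  assumes "i < a * b"
  shows "i div b < a" "i mod b < b"
proof -
  have "0 < b" using assms by (cases b) auto
  then show "i div b < a" "i mod b < b"
    using assms by (auto simp: less_mult_imp_div_less)
qed

lemma dim_kron [simp]:
  "dim_row (A \<otimes>\<^sub>K B) = dim_row A * dim_row B" "dim_col (A \<otimes>\<^sub>K B) = dim_col A * dim_col B"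
  by (simp_all add: kron_def)

lemma kron_carrier [simp]:
  "A \<in> carrier_mat a b \<Longrightarrow> B \<in> carrier_mat c d \<Longrightarrow> A \<otimes>\<^sub>K B \<in> carrier_mat (a * c) (b * d)"
  by (intro carrier_matI) auto

lemma index_kron:
  "i < dim_row A * dim_row B \<Longrightarrow> j < dim_col A * dim_col B \<Longrightarrow>
     (A \<otimes>\<^sub>K B) $$ (i, j) =
       A $$ (i div dim_row B, j div dim_col B) * B $$ (i mod dim_row B, j mod dim_col B)"
  by (simp add: kron_def)

lemma kron_mult:
  assumes "dim_col A = dim_row C" "dim_col B = dim_row D"
  shows "(A \<otimes>\<^sub>K B) * (C \<otimes>\<^sub>K D) = (A * C) \<otimes>\<^sub>K (B * D)"
proof (rule eq_matI)
  fix i j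
  assume "i < dim_row ((A * C) \<otimes>\<^sub>K (B * D))" "j < dim_col ((A * C) \<otimes>\<^sub>K (B * D))"
  then have i: "i < dim_row A * dim_row B" and j: "j < dim_col C * dim_col D" by auto
  note ib = div_mod_bound [OF i] and jb = div_mod_bound [OF j]
  let ?f = "\<lambda>k l. (A $$ (i div dim_row B, k) * C $$ (k, j div dim_col D))
                 * (B $$ (i mod dim_row B, l) * D $$ (l, j mod dim_col D))"
  have "((A \<otimes>\<^sub>K B) * (C \<otimes>\<^sub>K D)) $$ (i, j)
      = (\<Sum>k<dim_row C * dim_row D. ?f (k div dim_row D) (k mod dim_row D))"
    using i j assms
    by (auto simp: scalar_prod_def index_kron lessThan_atLeast0 intro!: sum.cong)
  also have "\<dots> = (\<Sum>k<dim_row C. \<Sum>l<dim_row D. ?f k l)"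
    by (rule sum_div_mod)
  also have "\<dots> = ((A * C) \<otimes>\<^sub>K (B * D)) $$ (i, j)"
    using i j ib jb assms
    by (simp add: index_kron scalar_prod_def lessThan_atLeast0 sum_product)
  finally show "((A \<otimes>\<^sub>K B) * (C \<otimes>\<^sub>K D)) $$ (i, j) = ((A * C) \<otimes>\<^sub>K (B * D)) $$ (i, j)" .
qed auto

lemma kron_assoc: "A \<otimes>\<^sub>K B \<otimes>\<^sub>K C = A \<otimes>\<^sub>K (B \<otimes>\<^sub>K C)"
proof (rule eq_matI)
  fix i j
  assume "i < dim_row (A \<otimes>\<^sub>K (B \<otimes>\<^sub>K C))" "j < dim_col (A \<otimes>\<^sub>K (B \<otimes>\<^sub>K C))"
  then have i: "i < dim_row A * dim_row B * dim_row C" "i < dim_row A * (dim_row B * dim_row C)"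
    and j: "j < dim_col A * dim_col B * dim_col C" "j < dim_col A * (dim_col B * dim_col C)"
    by (simp_all add: mult.assoc)
  have split: "k div (b * c) = k div c div b" "k mod (b * c) div c = k div c mod b"
    "k mod (b * c) mod c = k mod c" if "k < a * b * c" for k a b c :: nat
  proof -
    have "0 < c" using that by (cases c) auto
    then show "k div (b * c) = k div c div b" "k mod (b * c) div c = k div c mod b"
      "k mod (b * c) mod c = k mod c"
      by (simp_all add: div_mult2_eq mod_mult2_eq mult.commute [of b c])
  qed
  show "(A \<otimes>\<^sub>K B \<otimes>\<^sub>K C) $$ (i, j) = (A \<otimes>\<^sub>K (B \<otimes>\<^sub>K C)) $$ (i, j)"
    using i j div_mod_bound [OF i(1)] div_mod_bound [OF j(1)]
      div_mod_bound [OF i(2)] div_mod_bound [OF j(2)]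
    by (simp add: index_kron split [OF i(1)] split [OF j(1)])
qed (auto simp: mult.assoc)

lemma kron_one: "1\<^sub>m a \<otimes>\<^sub>K 1\<^sub>m b = 1\<^sub>m (a * b)"
proof (rule eq_matI)
  fix i j
  assume "i < dim_row (1\<^sub>m (a * b))" "j < dim_col (1\<^sub>m (a * b))"
  then have "i < a * b" "j < a * b" by auto
  note b = this div_mod_bound [OF this(1)] div_mod_bound [OF this(2)]
  have "i = j \<longleftrightarrow> i div b = j div b \<and> i mod b = j mod b"
    by (metis div_mult_mod_eq)
  with b show "(1\<^sub>m a \<otimes>\<^sub>K 1\<^sub>m b) $$ (i, j) = 1\<^sub>m (a * b) $$ (i, j)"
    by (auto simp: index_kron)
qed auto

lemma kron_smult_left: "(c \<cdot>\<^sub>m A) \<otimes>\<^sub>K B = c \<cdot>\<^sub>m (A \<otimes>\<^sub>K B)"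
  by (rule eq_matI) (auto simp: index_kron div_mod_bound)

lemma kron_smult_right: "A \<otimes>\<^sub>K (c \<cdot>\<^sub>m B) = c \<cdot>\<^sub>m (A \<otimes>\<^sub>K B)"
  by (rule eq_matI) (auto simp: index_kron div_mod_bound)

lemma one_kron [simp]: "1\<^sub>m 1 \<otimes>\<^sub>K A = A"
  by (rule eq_matI) (auto simp: index_kron)

lemma kron_one_right [simp]: "A \<otimes>\<^sub>K 1\<^sub>m 1 = A"
  by (rule eq_matI) (auto simp: index_kron)

lemma dim_mat_adjoint [simp]:
  "dim_row (mat_adjoint A) = dim_col A" "dim_col (mat_adjoint A) = dim_row A"
  by (simp_all add: mat_adjoint_def)

lemma index_mat_adjoint [simp]:
  fixes A :: "complex mat"
  shows "i < dim_col A \<Longrightarrow> j < dim_row A \<Longrightarrow> mat_adjoint A $$ (i, j) = cnj (A $$ (j, i))"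
  by (simp add: mat_adjoint_def mat_of_rows_index)

lemma kron_adjoint: "mat_adjoint (A \<otimes>\<^sub>K B) = mat_adjoint A \<otimes>\<^sub>K mat_adjoint B"
  by (rule eq_matI) (auto simp: index_kron div_mod_bound)

definition trace :: "complex mat \<Rightarrow> complex" where
  "trace A = (\<Sum>i<dim_row A. A $$ (i, i))"

lemma trace_kron:
  assumes "dim_row A = dim_col A" "dim_row B = dim_col B"
  shows "trace (A \<otimes>\<^sub>K B) = trace A * trace B"
proof -
  have "trace (A \<otimes>\<^sub>K B) = (\<Sum>k<dim_row A * dim_row B.
      A $$ (k div dim_row B, k div dim_row B) * B $$ (k mod dim_row B, k mod dim_row B))"
    unfolding trace_def using assms by (auto simp: index_kron)
  also have "\<dots> = trace A * trace B"
    by (subst sum_div_mod [of "\<lambda>i j. A $$ (i, i) * B $$ (j, j)"]) (simp add: trace_def sum_product)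
  finally show ?thesis .
qed

lemma trace_add:
  "A \<in> carrier_mat n n \<Longrightarrow> B \<in> carrier_mat n n \<Longrightarrow> trace (A + B) = trace A + trace B"
  by (auto simp: trace_def sum.distrib)

lemma trace_smult: "A \<in> carrier_mat n n \<Longrightarrow> trace (c \<cdot>\<^sub>m A) = c * trace A"
  by (auto simp: trace_def sum_distrib_left)

lemma trace_one: "trace (1\<^sub>m n) = of_nat n"
  by (simp add: trace_def)

lemma kron_add_left:
  "A \<in> carrier_mat a b \<Longrightarrow> B \<in> carrier_mat a b \<Longrightarrow> (A + B) \<otimes>\<^sub>K C = A \<otimes>\<^sub>K C + B \<otimes>\<^sub>K C"
  by (rule eq_matI) (auto simp: index_kron div_mod_bound distrib_right)

lemma mat_adjoint_mult:
  fixes A B :: "complex mat"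
  assumes "dim_col A = dim_row B"
  shows "mat_adjoint (A * B) = mat_adjoint B * mat_adjoint A"
  using assms
  by (intro eq_matI) (auto simp: scalar_prod_def mult.commute intro!: sum.cong)

lemma mat_adjoint_adjoint [simp]:
  fixes A :: "complex mat"
  shows "mat_adjoint (mat_adjoint A) = A"
  by (rule eq_matI) auto

lemma mat_adjoint_one [simp]: "mat_adjoint (1\<^sub>m n :: complex mat) = 1\<^sub>m n"
  by (rule eq_matI) auto

lemma mat_adjoint_carrier: "A \<in> carrier_mat n m \<Longrightarrow> mat_adjoint A \<in> carrier_mat m n"
  by auto

lemma smult_smult_mat: "s \<cdot>\<^sub>m (t \<cdot>\<^sub>m A) = (s * t :: complex) \<cdot>\<^sub>m A"
  by (rule eq_matI) (auto simp: mult.assoc)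

lemma scalar_mult_mat:
  fixes A :: "complex mat"
  assumes "A \<in> carrier_mat N N"
  shows "(c \<cdot>\<^sub>m 1\<^sub>m N) * A = c \<cdot>\<^sub>m A" "A * (c \<cdot>\<^sub>m 1\<^sub>m N) = c \<cdot>\<^sub>m A"
  using mult_smult_assoc_mat [OF one_carrier_mat assms, of c] mult_smult_distrib [OF assms one_carrier_mat, of c]
    assms by simp_all

section \<open>Pauli strings\<close>

text \<open>
  Pauli matrices are kept as names, so that an \<open>n\<close>-qubit Pauli operator is a list and the action of
  a gate is an operation on lists.
\<close>

datatype pauli = PauliI | PauliX | PauliY | PauliZ

lemma UNIV_pauli: "UNIV = {PauliI, PauliX, PauliY, PauliZ}"
  using pauli.exhaust by auto

text \<open>
  The parameter \<open>q\<close> stands for \<open>\<omega>\<^sup>2\<close>, which may be either square root of \<open>-1\<close>; the other choice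
  replaces \<open>Y\<close> by \<open>-Y\<close>. With this convention \<open>S X = Y S\<close> holds in both cases.
\<close>

fun pauli_gate :: "complex \<Rightarrow> pauli \<Rightarrow> complex mat" where
  "pauli_gate q PauliI = mat_of_rows_list 2 [[1, 0], [0, 1]]"
| "pauli_gate q PauliX = mat_of_rows_list 2 [[0, 1], [1, 0]]"
| "pauli_gate q PauliY = mat_of_rows_list 2 [[0, -q], [q, 0]]"
| "pauli_gate q PauliZ = mat_of_rows_list 2 [[1, 0], [0, -1]]"

fun pauli_mat :: "complex \<Rightarrow> pauli list \<Rightarrow> complex mat" where
  "pauli_mat q [] = 1\<^sub>m 1"
| "pauli_mat q (a # p) = pauli_gate q a \<otimes>\<^sub>K pauli_mat q p"

lemma mat_of_rows_list_2_index:
  "i < 2 \<Longrightarrow> j < 2 \<Longrightarrow> mat_of_rows_list 2 [[a, b], [c, d]] $$ (i, j)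
     = (if i = 0 then if j = 0 then a else b else if j = 0 then c else d)"
  by (auto simp: mat_of_rows_list_def less_2_cases_iff)

lemma mat_of_rows_list_2_dim [simp]:
  "dim_row (mat_of_rows_list 2 [[a, b], [c, d]]) = 2"
  "dim_col (mat_of_rows_list 2 [[a, b], [c, d]]) = 2"
  by (auto simp: mat_of_rows_list_def)

lemma mult_mat_of_rows_list_2:
  fixes a :: "'a :: semiring_0"
  shows "mat_of_rows_list 2 [[a, b], [c, d]] * mat_of_rows_list 2 [[a', b'], [c', d']]
    = mat_of_rows_list 2 [[a * a' + b * c', a * b' + b * d'], [c * a' + d * c', c * b' + d * d']]"
  by (rule eq_matI)
     (auto simp: scalar_prod_def mat_of_rows_list_2_index less_2_cases_iff
        atLeast0LessThan lessThan_nat_numeral add.commute)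

lemma smult_mat_of_rows_list_2:
  "k \<cdot>\<^sub>m mat_of_rows_list 2 [[a, b], [c, d]] = mat_of_rows_list 2 [[k * a, k * b], [k * c, k * d]]"
  by (rule eq_matI) (auto simp: mat_of_rows_list_2_index)

lemma adjoint_mat_of_rows_list_2:
  "mat_adjoint (mat_of_rows_list 2 [[a, b], [c, d]])
     = mat_of_rows_list 2 [[cnj a, cnj c], [cnj b, cnj d]]"
  by (rule eq_matI) (auto simp: mat_of_rows_list_2_index)

lemma trace_mat_of_rows_list_2: "trace (mat_of_rows_list 2 [[a, b], [c, d]]) = a + d"
  by (simp add: trace_def mat_of_rows_list_2_index lessThan_nat_numeral)

lemma one_mat_2: "1\<^sub>m 2 = mat_of_rows_list 2 [[1, 0], [0, 1]]"
  by (rule eq_matI) (auto simp: mat_of_rows_list_2_index)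

lemmas mat_2_simps = mult_mat_of_rows_list_2 smult_mat_of_rows_list_2 adjoint_mat_of_rows_list_2
  trace_mat_of_rows_list_2 one_mat_2

lemma dim_pauli_gate [simp]: "dim_row (pauli_gate q a) = 2" "dim_col (pauli_gate q a) = 2"
  by (cases a; simp)+

lemma dim_pauli_mat [simp]:
  "dim_row (pauli_mat q p) = 2 ^ length p" "dim_col (pauli_mat q p) = 2 ^ length p"
  by (induction p) auto

lemma pauli_mat_carrier: "length p = n \<Longrightarrow> pauli_mat q p \<in> carrier_mat (2 ^ n) (2 ^ n)"
  by (auto intro!: carrier_matI)

lemma pauli_mat_append: "pauli_mat q (xs @ ys) = pauli_mat q xs \<otimes>\<^sub>K pauli_mat q ys"
  by (induction xs) (simp_all add: kron_assoc del: One_nat_def)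

lemma pauli_mat_identity: "pauli_mat q (replicate n PauliI) = 1\<^sub>m (2 ^ n)"
  by (induction n) (simp_all flip: one_mat_2 add: kron_one)

text \<open>
  The Pauli strings are orthogonal for the trace form. This yields both that distinct
  strings are different matrices and that a string other than the identity has trace 0.
\<close>

lemma trace_pauli_mult:
  assumes "q\<^sup>2 = -1" "length p = length r"
  shows "trace (pauli_mat q p * pauli_mat q r) = (if p = r then 2 ^ length p else 0)"
  using assms(2)
proof (induction p r rule: list_induct2)
  case Nil
  then show ?case by (simp add: trace_one)
next
  case (Cons a p b r)
  have "trace (pauli_gate q a * pauli_gate q b) = (if a = b then 2 else 0)"
    using assms(1) by (cases a; cases b; simp add: mat_2_simps power2_eq_square)
  then show ?case
    using Cons by (simp add: kron_mult trace_kron)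
qed

lemma pauli_mat_square:
  assumes "q\<^sup>2 = -1"
  shows "pauli_mat q p * pauli_mat q p = 1\<^sub>m (2 ^ length p)"
proof (induction p)
  case (Cons a p)
  have "pauli_gate q a * pauli_gate q a = 1\<^sub>m 2"
    using assms by (cases a; simp add: mat_2_simps power2_eq_square)
  with Cons show ?case by (simp add: kron_mult kron_one)
qed simp

text \<open>
  Dual to orthogonality: the \<open>4\<^sup>n\<close> strings form a basis of the matrices, and the sum of
  \<open>P \<otimes> P\<close> over this basis is \<open>2\<^sup>n\<close> times the swap operator. The case of one qubit is a
  finite check, and the sum factors along the first qubit.
\<close>

lemma pauli_completeness:
  assumes q: "q\<^sup>2 = -1"
    and "i < 2 ^ n" "j < 2 ^ n" "k < 2 ^ n" "l < 2 ^ n"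
  shows "(\<Sum>p | length p = n. pauli_mat q p $$ (i, j) * pauli_mat q p $$ (k, l))
       = (if i = l \<and> j = k then 2 ^ n else 0)"
  using assms(2-)
proof (induction n arbitrary: i j k l)
  case 0
  then show ?case by simp
next
  case (Suc n)
  let ?m = "2 ^ n :: nat"
  have gate: "(\<Sum>a\<in>UNIV. pauli_gate q a $$ (i', j') * pauli_gate q a $$ (k', l'))
      = (if i' = l' \<and> j' = k' then 2 else 0)"
    if "i' < 2" "j' < 2" "k' < 2" "l' < 2" for i' j' k' l'
    using that q
    by (auto simp: UNIV_pauli mat_of_rows_list_2_index power2_eq_square less_2_cases_iff)
  have bounds: "x div ?m < 2" "x mod ?m < ?m" if "x < 2 ^ Suc n" for x
    using div_mod_bound [of x 2 ?m] that by simp_all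
  have strings: "{p. length p = Suc n} = (\<lambda>(a, p). a # p) ` (UNIV \<times> {p :: pauli list. length p = n})"
    by (auto simp: length_Suc_conv image_iff)
  have "(\<Sum>p | length p = Suc n. pauli_mat q p $$ (i, j) * pauli_mat q p $$ (k, l))
      = (\<Sum>(a, p)\<in>UNIV \<times> {p. length p = n}.
          pauli_mat q (a # p) $$ (i, j) * pauli_mat q (a # p) $$ (k, l))"
    unfolding strings by (subst sum.reindex) (auto simp: inj_on_def case_prod_unfold)
  also have "\<dots> = (\<Sum>(a, p)\<in>UNIV \<times> {p. length p = n}.
        (pauli_gate q a $$ (i div ?m, j div ?m) * pauli_gate q a $$ (k div ?m, l div ?m))
      * (pauli_mat q p $$ (i mod ?m, j mod ?m) * pauli_mat q p $$ (k mod ?m, l mod ?m)))"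
    using Suc.prems by (intro sum.cong) (auto simp: index_kron)
  also have "\<dots> = (\<Sum>a\<in>UNIV. pauli_gate q a $$ (i div ?m, j div ?m) * pauli_gate q a $$ (k div ?m, l div ?m))
      * (\<Sum>p | length p = n. pauli_mat q p $$ (i mod ?m, j mod ?m) * pauli_mat q p $$ (k mod ?m, l mod ?m))"
    by (simp add: sum_product sum.cartesian_product)
  also have "\<dots> = (if i div ?m = l div ?m \<and> j div ?m = k div ?m then 2 else 0)
      * (if i mod ?m = l mod ?m \<and> j mod ?m = k mod ?m then 2 ^ n else 0)"
    using Suc.prems by (simp add: gate bounds Suc.IH)
  also have "\<dots> = (if i = l \<and> j = k then 2 ^ Suc n else 0)"
  proof -
    have "x = y \<longleftrightarrow> x div ?m = y div ?m \<and> x mod ?m = y mod ?m" for x y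
      by (metis div_mult_mod_eq)
    from this [of i l] this [of j k] show ?thesis by auto
  qed
  finally show ?case .
qed

lemma finite_pauli_strings: "finite {p :: pauli list. length p = n}"
  and card_pauli_strings: "card {p :: pauli list. length p = n} = 4 ^ n"
proof -
  have "finite (UNIV :: pauli set)" "card (UNIV :: pauli set) = 4"
    by (simp_all add: UNIV_pauli)
  then show "finite {p :: pauli list. length p = n}" "card {p :: pauli list. length p = n} = 4 ^ n"
    using finite_lists_length_eq [of "UNIV :: pauli set" n] card_lists_length_eq [of "UNIV :: pauli set" n]
    by simp_all
qed

text \<open>
  The average of the conjugates of a matrix over all Pauli strings is scalar, with the
  trace as the only surviving information.
\<close>

lemma pauli_twirl:
  assumes q: "q\<^sup>2 = -1" and M: "M \<in> carrier_mat (2 ^ n) (2 ^ n)" and "i < 2 ^ n" "l < 2 ^ n"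
  shows "(\<Sum>p | length p = n. (pauli_mat q p * M * pauli_mat q p) $$ (i, l))
       = (if i = l then 2 ^ n * trace M else 0)"
proof -
  let ?N = "2 ^ n :: nat"
  let ?S = "{p :: pauli list. length p = n}"
  have entry: "(pauli_mat q p * M * pauli_mat q p) $$ (i, l)
      = (\<Sum>k<?N. \<Sum>j<?N. M $$ (j, k) * (pauli_mat q p $$ (i, j) * pauli_mat q p $$ (k, l)))"
    if "p \<in> ?S" for p
    using that M \<open>i < ?N\<close> \<open>l < ?N\<close>
    by (auto simp: scalar_prod_def lessThan_atLeast0 sum_distrib_right sum_distrib_left mult_ac intro!: sum.cong)
  have "(\<Sum>p\<in>?S. (pauli_mat q p * M * pauli_mat q p) $$ (i, l))
      = (\<Sum>p\<in>?S. \<Sum>k<?N. \<Sum>j<?N. M $$ (j, k) * (pauli_mat q p $$ (i, j) * pauli_mat q p $$ (k, l)))"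
    by (rule sum.cong [OF refl]) (rule entry)
  also have "\<dots> = (\<Sum>k<?N. \<Sum>j<?N. M $$ (j, k) * (\<Sum>p\<in>?S. pauli_mat q p $$ (i, j) * pauli_mat q p $$ (k, l)))"
    by (simp add: sum_distrib_left sum.swap [where A = ?S])
  also have "\<dots> = (\<Sum>k<?N. \<Sum>j<?N. M $$ (j, k) * (if i = l \<and> j = k then 2 ^ n else 0))"
    using assms by (intro sum.cong refl) (subst pauli_completeness [OF q], auto)
  also have "\<dots> = (\<Sum>k<?N. M $$ (k, k) * (if i = l then 2 ^ n else 0))"
    by (intro sum.cong refl) (simp add: if_distrib sum.delta cong: if_cong)
  also have "\<dots> = (if i = l then 2 ^ n * trace M else 0)"
    using M by (simp add: trace_def sum_distrib_left mult.commute)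
  finally show ?thesis .
qed

text \<open>
  A matrix that commutes with all strings is fixed by every term of the twirl, so \<open>4\<^sup>n M\<close> equals the scalar
  matrix that the twirl produces.
\<close>

lemma commutes_with_paulis_imp_scalar:
  assumes q: "q\<^sup>2 = -1" and M: "M \<in> carrier_mat (2 ^ n) (2 ^ n)"
    and comm: "\<And>p. length p = n \<Longrightarrow> M * pauli_mat q p = pauli_mat q p * M"
  obtains c where "M = c \<cdot>\<^sub>m 1\<^sub>m (2 ^ n)"
proof -
  have conj: "pauli_mat q p * M * pauli_mat q p = M" if "length p = n" for p
  proof -
    note P = pauli_mat_carrier [OF that, of q]
    have "pauli_mat q p * M * pauli_mat q p = M * (pauli_mat q p * pauli_mat q p)"
      using assoc_mult_mat [OF M P P] comm [OF that] by simp
    then show ?thesis using M pauli_mat_square [OF q, of p] that by simp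
  qed
  have "4 ^ n * M $$ (i, l) = (if i = l then 2 ^ n * trace M else 0)" if "i < 2 ^ n" "l < 2 ^ n" for i l
  proof -
    have "(\<Sum>p | length p = n. (pauli_mat q p * M * pauli_mat q p) $$ (i, l))
        = (\<Sum>p | length (p :: pauli list) = n. M $$ (i, l))"
      by (rule sum.cong) (auto simp: conj)
    then show ?thesis
      using pauli_twirl [OF q M that] by (simp add: card_pauli_strings)
  qed
  note scaled = this
  have "M $$ (i, l) = (if i = l then 2 ^ n * trace M / 4 ^ n else 0)" if "i < 2 ^ n" "l < 2 ^ n" for i l
    using scaled [OF that] by (simp add: field_simps split: if_splits)
  then have "M = (2 ^ n * trace M / 4 ^ n) \<cdot>\<^sub>m 1\<^sub>m (2 ^ n)"
    using M by (intro eq_matI) auto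
  then show thesis by (rule that)
qed

section \<open>The ring generated by the entries of the gates\<close>

lemma primitive_8th_root:
  assumes "primitive_root_of_unity 8 \<omega>"
  shows "\<omega> ^ 4 = -1" "\<omega> \<noteq> 0" "cnj \<omega> = - (\<omega> ^ 3)" "(\<omega>\<^sup>2)\<^sup>2 = -1" "cmod \<omega> = 1"
proof -
  have 8: "\<omega> ^ 8 = 1" and 4: "\<omega> ^ 4 \<noteq> 1"
    using assms unfolding primitive_root_of_unity_def by auto
  have "(\<omega> ^ 4)\<^sup>2 = 1" using 8 by (simp flip: power_mult)
  with 4 show w4: "\<omega> ^ 4 = -1" by (metis power2_eq_1_iff)
  then show "(\<omega>\<^sup>2)\<^sup>2 = -1" by (simp flip: power_mult)
  show "\<omega> \<noteq> 0" using 8 by auto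
  have "cmod \<omega> ^ 8 = 1" using 8 by (metis norm_one norm_power)
  then show m: "cmod \<omega> = 1" using power_eq_imp_eq_base [of "cmod \<omega>" 8 1] by simp
  then have "\<omega> * cnj \<omega> = 1" by (simp add: complex_norm_square [symmetric])
  moreover have "\<omega> * (- (\<omega> ^ 3)) = 1" using w4 by (simp add: eval_nat_numeral)
  ultimately show "cnj \<omega> = - (\<omega> ^ 3)" using \<open>\<omega> \<noteq> 0\<close> by (metis mult_left_cancel)
qed

text \<open>
  Coordinates of an element of \<open>\<int>[\<omega>]\<close> in the basis of powers of \<open>\<omega>\<close>.
\<close>

definition ring_elem :: "complex \<Rightarrow> int \<Rightarrow> int \<Rightarrow> int \<Rightarrow> int \<Rightarrow> complex" where
  "ring_elem \<omega> a b c d = of_int a + of_int b * \<omega> + of_int c * \<omega>\<^sup>2 + of_int d * \<omega> ^ 3"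

text \<open>
  This is \<open>\<int>[\<omega>, 1/2]\<close>. It contains \<open>1/\<surd>2\<close>, since \<open>\<omega> - \<omega>\<^sup>3 = \<plusminus>\<surd>2\<close>, and hence the entries of all
  gates.
\<close>

definition gate_ring :: "complex \<Rightarrow> complex set" where
  "gate_ring \<omega> = {z. \<exists>k a b c d. 2 ^ k * z = ring_elem \<omega> a b c d}"

lemma ring_elem_add:
  "ring_elem \<omega> a b c d + ring_elem \<omega> a' b' c' d' = ring_elem \<omega> (a + a') (b + b') (c + c') (d + d')"
  by (simp add: ring_elem_def algebra_simps)

lemma ring_elem_scale:
  "of_int m * ring_elem \<omega> a b c d = ring_elem \<omega> (m * a) (m * b) (m * c) (m * d)"
  by (simp add: ring_elem_def algebra_simps)

lemma ring_elem_mult: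
  assumes "\<omega> ^ 4 = -1"
  shows "ring_elem \<omega> a b c d * ring_elem \<omega> a' b' c' d' =
    ring_elem \<omega> (a * a' - b * d' - c * c' - d * b') (a * b' + b * a' - c * d' - d * c')
      (a * c' + b * b' + c * a' - d * d') (a * d' + b * c' + c * b' + d * a')"
proof -
  have *: "\<omega> * (\<omega> * (\<omega> * (\<omega> * z))) = - z" for z
    using assms by (simp add: eval_nat_numeral flip: mult.assoc)
  show ?thesis
    by (simp add: ring_elem_def eval_nat_numeral algebra_simps *)
qed

lemma cnj_ring_elem:
  assumes "primitive_root_of_unity 8 \<omega>"
  shows "cnj (ring_elem \<omega> a b c d) = ring_elem \<omega> a (-d) (-c) (-b)"
proof -
  have "(- (\<omega> ^ 3))\<^sup>2 = \<omega> ^ 4 * \<omega>\<^sup>2" "(- (\<omega> ^ 3)) ^ 3 = - (\<omega> ^ 4 * \<omega> ^ 4 * \<omega>)"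
    by (simp_all add: eval_nat_numeral)
  then show ?thesis
    by (simp add: ring_elem_def primitive_8th_root [OF assms])
qed

lemma gate_ring_add:
  assumes "x \<in> gate_ring \<omega>" "y \<in> gate_ring \<omega>"
  shows "x + y \<in> gate_ring \<omega>"
proof -
  obtain k a b c d l a' b' c' d' where
    x: "2 ^ k * x = ring_elem \<omega> a b c d" and y: "2 ^ l * y = ring_elem \<omega> a' b' c' d'"
    using assms by (auto simp: gate_ring_def)
  have "2 ^ (k + l) * (x + y) = of_int (2 ^ l) * (2 ^ k * x) + of_int (2 ^ k) * (2 ^ l * y)"
    by (simp add: power_add algebra_simps)
  then show ?thesis
    unfolding x y ring_elem_scale ring_elem_add gate_ring_def by blast
qed

lemma gate_ring_mult:
  assumes "\<omega> ^ 4 = -1" "x \<in> gate_ring \<omega>" "y \<in> gate_ring \<omega>"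
  shows "x * y \<in> gate_ring \<omega>"
proof -
  obtain k a b c d l a' b' c' d' where
    x: "2 ^ k * x = ring_elem \<omega> a b c d" and y: "2 ^ l * y = ring_elem \<omega> a' b' c' d'"
    using assms by (auto simp: gate_ring_def)
  have "2 ^ (k + l) * (x * y) = (2 ^ k * x) * (2 ^ l * y)"
    by (simp add: power_add algebra_simps)
  then show ?thesis
    unfolding x y ring_elem_mult [OF assms(1)] gate_ring_def by blast
qed

lemma gate_ring_basic:
  "0 \<in> gate_ring \<omega>" "1 \<in> gate_ring \<omega>" "-1 \<in> gate_ring \<omega>" "\<omega> \<in> gate_ring \<omega>"
  "1 / 2 \<in> gate_ring \<omega>"
proof -
  have "2 ^ 0 * 0 = ring_elem \<omega> 0 0 0 0" "2 ^ 0 * 1 = ring_elem \<omega> 1 0 0 0"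
    "2 ^ 0 * -1 = ring_elem \<omega> (-1) 0 0 0" "2 ^ 0 * \<omega> = ring_elem \<omega> 0 1 0 0"
    "2 ^ 1 * (1 / 2) = ring_elem \<omega> 1 0 0 0"
    by (simp_all add: ring_elem_def)
  then show "0 \<in> gate_ring \<omega>" "1 \<in> gate_ring \<omega>" "-1 \<in> gate_ring \<omega>" "\<omega> \<in> gate_ring \<omega>"
    "1 / 2 \<in> gate_ring \<omega>"
    unfolding gate_ring_def by blast+
qed

lemma gate_ring_power: "\<omega> ^ 4 = -1 \<Longrightarrow> x \<in> gate_ring \<omega> \<Longrightarrow> x ^ k \<in> gate_ring \<omega>"
  by (induction k) (simp_all add: gate_ring_basic gate_ring_mult)

lemma gate_ring_sum:
  "(\<And>i. i \<in> A \<Longrightarrow> f i \<in> gate_ring \<omega>) \<Longrightarrow> sum f A \<in> gate_ring \<omega>"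
  by (induction A rule: infinite_finite_induct) (simp_all add: gate_ring_basic gate_ring_add)

lemma gate_ring_uminus: "\<omega> ^ 4 = -1 \<Longrightarrow> x \<in> gate_ring \<omega> \<Longrightarrow> - x \<in> gate_ring \<omega>"
  using gate_ring_mult [of \<omega> "-1" x] gate_ring_basic(3) by simp

lemma gate_ring_diff:
  "\<omega> ^ 4 = -1 \<Longrightarrow> x \<in> gate_ring \<omega> \<Longrightarrow> y \<in> gate_ring \<omega> \<Longrightarrow> x - y \<in> gate_ring \<omega>"
  using gate_ring_add [of x \<omega> "- y"] gate_ring_uminus by simp

lemma gate_ring_cnj:
  assumes "primitive_root_of_unity 8 \<omega>" "x \<in> gate_ring \<omega>"
  shows "cnj x \<in> gate_ring \<omega>"
proof -
  obtain k a b c d where x: "2 ^ k * x = ring_elem \<omega> a b c d"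
    using assms by (auto simp: gate_ring_def)
  have "2 ^ k * cnj x = cnj (ring_elem \<omega> a b c d)"
    using arg_cong [OF x, of cnj] by simp
  also have "\<dots> = ring_elem \<omega> a (-d) (-c) (-b)"
    by (rule cnj_ring_elem [OF assms(1)])
  finally show ?thesis unfolding gate_ring_def by blast
qed

text \<open>
  \<open>\<omega> - \<omega>\<^sup>3 = \<omega> + cnj \<omega>\<close> is a square root of 2, of either sign depending on \<open>\<omega>\<close>.
\<close>

lemma square_diff_8th_root:
  assumes "primitive_root_of_unity 8 \<omega>"
  obtains r :: real where "\<omega> - \<omega> ^ 3 = of_real r" "r\<^sup>2 = 2"
proof -
  note w = primitive_8th_root [OF assms]
  have "\<omega> - \<omega> ^ 3 = \<omega> + cnj \<omega>" using w by simp
  then have r: "\<omega> - \<omega> ^ 3 = of_real (2 * Re \<omega>)" by (simp add: complex_add_cnj)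
  have "(\<omega> - \<omega> ^ 3)\<^sup>2 = \<omega>\<^sup>2 - 2 * \<omega> ^ 4 + \<omega> ^ 4 * \<omega>\<^sup>2"
    by (simp add: power2_eq_square eval_nat_numeral algebra_simps)
  then have "(\<omega> - \<omega> ^ 3)\<^sup>2 = 2" using w by simp
  then have "of_real ((2 * Re \<omega>)\<^sup>2) = (of_real 2 :: complex)"
    unfolding r by simp
  then have "(2 * Re \<omega>)\<^sup>2 = 2" by (simp only: of_real_eq_iff)
  with r show thesis by (rule that)
qed

lemma inverse_sqrt_2_in_gate_ring:
  assumes "primitive_root_of_unity 8 \<omega>"
  shows "1 / complex_of_real (sqrt 2) \<in> gate_ring \<omega>"
proof -
  note w = primitive_8th_root [OF assms]
  obtain r :: real where r: "\<omega> - \<omega> ^ 3 = of_real r" "r\<^sup>2 = 2"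
    using square_diff_8th_root [OF assms] .
  have "1 / complex_of_real (sqrt 2) = (1 / 2) * complex_of_real (sqrt 2)"
    by (simp add: field_simps flip: of_real_mult)
  moreover have "sqrt 2 = r \<or> sqrt 2 = - r"
    using r(2) by (metis real_sqrt_abs abs_if)
  then have "complex_of_real (sqrt 2) = \<omega> + - (\<omega> ^ 3) \<or> complex_of_real (sqrt 2) = - (\<omega> + - (\<omega> ^ 3))"
    using r(1) by auto
  then have "complex_of_real (sqrt 2) \<in> gate_ring \<omega>"
    using w(1) by (auto intro!: gate_ring_diff gate_ring_uminus gate_ring_power gate_ring_basic)
  ultimately show ?thesis using w(1) by (simp only: gate_ring_mult gate_ring_basic)
qed

lemma irrational_sqrt_2:
  fixes r :: real and m k :: int
  assumes "r\<^sup>2 = 2" "of_int m + r * of_int k = 0"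
  shows "k = 0" "m = 0"
proof -
  have "of_int m = - (r * of_int k)" using assms(2) by linarith
  then have "(of_int m)\<^sup>2 = r\<^sup>2 * (of_int k)\<^sup>2" by (simp add: power_mult_distrib)
  then have "of_int (m\<^sup>2) = (of_int (2 * k\<^sup>2) :: real)" using assms(1) by simp
  then have eq: "m\<^sup>2 = 2 * k\<^sup>2" by (simp only: of_int_eq_iff)
  show "k = 0"
  proof (rule ccontr)
    assume k: "k \<noteq> 0"
    then have m: "m \<noteq> 0" using eq by auto
    have "multiplicity 2 (m\<^sup>2) = 2 * multiplicity 2 m"
      using m by (simp add: prime_elem_multiplicity_power_distrib)
    moreover have "multiplicity 2 (2 * k\<^sup>2) = Suc (2 * multiplicity 2 k)"
      using k by (simp add: prime_elem_multiplicity_power_distrib multiplicity_times_same)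
    ultimately have "2 * multiplicity 2 m = Suc (2 * multiplicity 2 k)" using eq by simp
    then show False by presburger
  qed
  with eq show "m = 0" by simp
qed

text \<open>
  Descent on \<open>k\<close>. A sum of four squares divisible by 4 has all terms even or all terms odd. In the odd
  case \<open>ab + bc + cd - ad\<close> is \<open>2\<close> modulo \<open>4\<close>, which the second equation excludes; in the even
  case both equations can be divided by 4.
\<close>

lemma orthogonal_four_squares:
  fixes a b c d :: int
  assumes "a\<^sup>2 + b\<^sup>2 + c\<^sup>2 + d\<^sup>2 = 4 ^ k" "a * b + b * c + c * d - a * d = 0"
  shows "\<exists>a' b' c' d'. a = 2 ^ k * a' \<and> b = 2 ^ k * b' \<and> c = 2 ^ k * c' \<and> d = 2 ^ k * d'
    \<and> a'\<^sup>2 + b'\<^sup>2 + c'\<^sup>2 + d'\<^sup>2 = 1"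
  using assms
proof (induction k arbitrary: a b c d)
  case 0
  then show ?case by simp
next
  case (Suc k)
  have sq: "\<exists>y. x\<^sup>2 = 4 * y + (if even x then 0 else 1)" for x :: int
  proof (cases "even x")
    case True
    then obtain y where "x = 2 * y" by blast
    then have "x\<^sup>2 = 4 * y\<^sup>2" by (simp add: power_mult_distrib)
    then show ?thesis using True by auto
  next
    case False
    then obtain y where "x = 2 * y + 1" using oddE by blast
    then have "x\<^sup>2 = 4 * (y\<^sup>2 + y) + 1" by (simp add: power2_eq_square algebra_simps)
    with False have "x\<^sup>2 = 4 * (y\<^sup>2 + y) + (if even x then 0 else 1)" by (simp only: if_False)
    then show ?thesis by (rule exI)
  qed
  obtain w x y z where "a\<^sup>2 = 4 * w + (if even a then 0 else 1)" "b\<^sup>2 = 4 * x + (if even b then 0 else 1)"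
    "c\<^sup>2 = 4 * y + (if even c then 0 else 1)" "d\<^sup>2 = 4 * z + (if even d then 0 else 1)"
    using sq by meson
  moreover define K :: int where "K = 4 ^ k"
  ultimately have sum: "4 * (w + x + y + z) + ((if even a then 0 else 1) + (if even b then 0 else 1)
      + (if even c then 0 else 1) + (if even d then 0 else 1)) = 4 * K"
    using Suc.prems(1) by simp
  have parity: "(even a \<and> even b \<and> even c \<and> even d) \<or> (odd a \<and> odd b \<and> odd c \<and> odd d)"
    using sum by (cases "even a"; cases "even b"; cases "even c"; cases "even d"; simp only: if_True if_False; presburger)
  have "\<not> (odd a \<and> odd b \<and> odd c \<and> odd d)"
  proof
    assume "odd a \<and> odd b \<and> odd c \<and> odd d"
    then obtain w x y z where "a = 2 * w + 1" "b = 2 * x + 1" "c = 2 * y + 1" "d = 2 * z + 1"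
      by (meson oddE)
    \<comment> \<open>With odd terms, \<open>b (a + c)\<close> and \<open>d (c - a)\<close> are even and exactly one of them is divisible by 4.\<close>
    then have "a * b + b * c + c * d - a * d
        = 4 * (w * x + x * y + y * z - w * z + x + y) + 2"
      by (simp add: algebra_simps)
    then show False using Suc.prems(2) by presburger
  qed
  with parity obtain w x y z where e: "a = 2 * w" "b = 2 * x" "c = 2 * y" "d = 2 * z"
    by (meson evenE)
  have "w\<^sup>2 + x\<^sup>2 + y\<^sup>2 + z\<^sup>2 = 4 ^ k" "w * x + x * y + y * z - w * z = 0"
    using Suc.prems by (simp_all add: e power_mult_distrib algebra_simps)
  from Suc.IH [OF this] show ?case
    unfolding e by (auto simp: algebra_simps)
qed

text \<open>
  The coordinates of \<open>2\<^sup>k x\<close> satisfy the two equations of the previous lemma: \<open>x cnj x = 1\<close> reads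
  \<open>N + M (\<omega> - \<omega>\<^sup>3) = 4\<^sup>k\<close> with integers \<open>N\<close> and \<open>M\<close>, and \<open>\<omega> - \<omega>\<^sup>3\<close> is irrational. After division by
  \<open>2\<^sup>k\<close>, a sum of four integer squares is 1, so only one coordinate is nonzero, and it is \<open>\<plusminus>1\<close>; the
  sign is absorbed by \<open>\<omega>\<^sup>4 = -1\<close>.
\<close>

lemma unit_modulus_in_gate_ring:
  assumes root: "primitive_root_of_unity 8 \<omega>" and x: "x \<in> gate_ring \<omega>" and unit: "x * cnj x = 1"
  obtains j where "x = \<omega> ^ j"
proof -
  note w = primitive_8th_root [OF root]
  obtain r :: real where r: "\<omega> - \<omega> ^ 3 = of_real r" "r\<^sup>2 = 2"
    using square_diff_8th_root [OF root] .
  obtain k a b c d where k: "2 ^ k * x = ring_elem \<omega> a b c d"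
    using x by (auto simp: gate_ring_def)
  note cnj = cnj_ring_elem [OF root, of a b c d]
  let ?N = "a\<^sup>2 + b\<^sup>2 + c\<^sup>2 + d\<^sup>2" and ?M = "a * b + b * c + c * d - a * d"
  have "of_int (4 ^ k) = (2 ^ k * x) * cnj (2 ^ k * x)"
    using unit by (simp add: algebra_simps flip: power_mult_distrib)
  also have "\<dots> = of_int ?N + of_int ?M * (\<omega> - \<omega> ^ 3)"
    unfolding k cnj ring_elem_mult [OF w(1)]
    by (simp add: ring_elem_def algebra_simps power2_eq_square)
  finally have "complex_of_real (of_int (?N - 4 ^ k) + r * of_int ?M) = of_real 0"
    unfolding r by (simp add: algebra_simps)
  then have "of_int (?N - 4 ^ k) + r * of_int ?M = 0"
    by (simp only: of_real_eq_iff)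
  from irrational_sqrt_2 [OF r(2) this] have "?N = 4 ^ k" "?M = 0" by auto
  from orthogonal_four_squares [OF this] obtain a' b' c' d'
    where e: "a = 2 ^ k * a'" "b = 2 ^ k * b'" "c = 2 ^ k * c'" "d = 2 ^ k * d'"
      and one: "a'\<^sup>2 + b'\<^sup>2 + c'\<^sup>2 + d'\<^sup>2 = 1"
    by blast
  have "2 ^ k * x = of_int (2 ^ k) * ring_elem \<omega> a' b' c' d'"
    unfolding k e ring_elem_scale ..
  then have x': "x = ring_elem \<omega> a' b' c' d'" by simp
  have small: "y\<^sup>2 = 0 \<or> y\<^sup>2 \<ge> 1" "y\<^sup>2 \<ge> 0" for y :: int
    by (cases "y = 0") (auto simp: int_one_le_iff_zero_less)
  have "\<exists>j. ring_elem \<omega> a' b' c' d' = \<omega> ^ j"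
  proof -
    have pow: "\<omega> ^ 4 = -1" "\<omega> ^ 5 = - \<omega>" "\<omega> ^ 6 = - \<omega>\<^sup>2" "\<omega> ^ 7 = - (\<omega> ^ 3)"
      using power_add [of \<omega> 4 1] power_add [of \<omega> 4 2] power_add [of \<omega> 4 3] w(1) by simp_all
    consider "a'\<^sup>2 = 1" "b' = 0" "c' = 0" "d' = 0" | "a' = 0" "b'\<^sup>2 = 1" "c' = 0" "d' = 0"
      | "a' = 0" "b' = 0" "c'\<^sup>2 = 1" "d' = 0" | "a' = 0" "b' = 0" "c' = 0" "d'\<^sup>2 = 1"
      using one small [of a'] small [of b'] small [of c'] small [of d']
      by (smt (verit) zero_eq_power2)
    then show ?thesis
    proof cases
      case 1
      then have "ring_elem \<omega> a' b' c' d' = \<omega> ^ 0 \<or> ring_elem \<omega> a' b' c' d' = \<omega> ^ 4"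
        by (auto simp: ring_elem_def pow power2_eq_1_iff)
      then show ?thesis by blast
    next
      case 2
      then have "ring_elem \<omega> a' b' c' d' = \<omega> ^ 1 \<or> ring_elem \<omega> a' b' c' d' = \<omega> ^ 5"
        by (auto simp: ring_elem_def pow power2_eq_1_iff)
      then show ?thesis by blast
    next
      case 3
      then have "ring_elem \<omega> a' b' c' d' = \<omega> ^ 2 \<or> ring_elem \<omega> a' b' c' d' = \<omega> ^ 6"
        by (auto simp: ring_elem_def pow power2_eq_1_iff)
      then show ?thesis by blast
    next
      case 4
      then have "ring_elem \<omega> a' b' c' d' = \<omega> ^ 3 \<or> ring_elem \<omega> a' b' c' d' = \<omega> ^ 7"
        by (auto simp: ring_elem_def pow power2_eq_1_iff)
      then show ?thesis by blast
    qed
  qed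
  then show thesis using x' that by blast
qed

section \<open>Conjugation in groups and quotients\<close>

lemma opposite_simps [simp]:
  "carrier (opposite G) = carrier G" "\<one>\<^bsub>opposite G\<^esub> = \<one>\<^bsub>G\<^esub>"
  "x \<otimes>\<^bsub>opposite G\<^esub> y = y \<otimes>\<^bsub>G\<^esub> x"
  by (simp_all add: opposite_def)

lemma (in group) group_opposite: "group (opposite G)"
  by (rule groupI) (auto simp: m_assoc intro: r_inv)

lemma (in group) inv_opposite: "x \<in> carrier G \<Longrightarrow> inv\<^bsub>opposite G\<^esub> x = inv x"
  by (rule group.inv_equality [OF group_opposite]) auto

context group
begin

lemma conjugate_by_closed:
  "g \<in> carrier G \<Longrightarrow> v \<in> carrier G \<Longrightarrow> conjugate_by G g v \<in> carrier G"
  by (simp add: conjugate_by_def)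

lemma conjugate_by_mult:
  assumes "g \<in> carrier G" "h \<in> carrier G" "v \<in> carrier G"
  shows "conjugate_by G (g \<otimes> h) v = conjugate_by G h (conjugate_by G g v)"
  using assms by (simp add: conjugate_by_def inv_mult_group m_assoc)

lemma conjugate_by_inv:
  assumes "g \<in> carrier G" "v \<in> carrier G"
  shows "conjugate_by G (inv g) (conjugate_by G g v) = v"
    "conjugate_by G g (conjugate_by G (inv g) v) = v"
proof -
  have "conjugate_by G \<one> v = v" using assms by (simp add: conjugate_by_def)
  then show "conjugate_by G (inv g) (conjugate_by G g v) = v"
    "conjugate_by G g (conjugate_by G (inv g) v) = v"
    using conjugate_by_mult [of g "inv g" v] conjugate_by_mult [of "inv g" g v] assms by auto
qed

lemma conjugate_by_fixes_iff:
  assumes "g \<in> carrier G" "v \<in> carrier G"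
  shows "conjugate_by G g v = v \<longleftrightarrow> v \<otimes> g = g \<otimes> v"
proof -
  have "conjugate_by G g v = v \<longleftrightarrow> inv g \<otimes> (v \<otimes> g) = v"
    using assms by (simp add: conjugate_by_def m_assoc)
  also have "\<dots> \<longleftrightarrow> v \<otimes> g = g \<otimes> v"
    using assms by (metis inv_solve_left m_closed)
  finally show ?thesis .
qed

lemma conjugacy_class_subset: "a \<in> carrier G \<Longrightarrow> conjugacy_class G a \<subseteq> carrier G"
  by (auto simp: conjugacy_class_def conjugate_by_closed)

lemma conjugate_by_conjugacy_class:
  assumes "a \<in> carrier G" "g \<in> carrier G" "v \<in> conjugacy_class G a"
  shows "conjugate_by G g v \<in> conjugacy_class G a"
  using assms by (auto simp: conjugacy_class_def) (metis conjugate_by_mult m_closed)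

text \<open>
  Conjugation by \<open>g \<otimes> h\<close> conjugates by \<open>g\<close> first. This is the order of composition in
  \<^const>\<open>symmetric_group\<close>, so the map is a homomorphism and not an antihomomorphism.
\<close>

lemma conjugation_perm_hom:
  assumes "V \<subseteq> carrier G" "\<And>g v. g \<in> carrier G \<Longrightarrow> v \<in> V \<Longrightarrow> conjugate_by G g v \<in> V"
  shows "conjugation_perm G V \<in> hom G (symmetric_group V)"
proof -
  have Bij: "conjugation_perm G V g \<in> Bij V" if "g \<in> carrier G" for g
  proof -
    have "bij_betw (conjugation_perm G V g) V V"
    proof (rule bij_betw_byWitness [where f' = "conjugate_by G (inv g)"])
      show "\<forall>v\<in>V. conjugate_by G (inv g) (conjugation_perm G V g v) = v"
        "\<forall>v\<in>V. conjugation_perm G V g (conjugate_by G (inv g) v) = v"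
        using assms that conjugate_by_inv by (auto simp: conjugation_perm_def subset_iff)
    qed (use assms that in \<open>auto simp: conjugation_perm_def\<close>)
    then show ?thesis by (simp add: Bij_def conjugation_perm_def)
  qed
  have "conjugation_perm G V (g \<otimes> h)
      = compose V (conjugation_perm G V h) (conjugation_perm G V g)"
    if "g \<in> carrier G" "h \<in> carrier G" for g h
    using assms that
    by (auto simp: conjugation_perm_def compose_def conjugate_by_mult subset_iff fun_eq_iff)
  with Bij show ?thesis
    by (auto simp: hom_def symmetric_group_def BijGroup_def opposite_def)
qed

text \<open>
  An element that acts trivially on \<open>V\<close> commutes with \<open>V\<close>, so the kernel is the centralizer of \<open>V\<close>.
\<close>

lemma conjugation_perm_inj:
  assumes "V \<subseteq> carrier G"
    and "\<And>g. g \<in> carrier G \<Longrightarrow> (\<And>v. v \<in> V \<Longrightarrow> v \<otimes> g = g \<otimes> v) \<Longrightarrow> g = \<one>"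
  shows "inj_on (conjugation_perm G V) (carrier G)"
proof (rule inj_onI)
  fix g h
  assume g: "g \<in> carrier G" and h: "h \<in> carrier G"
    and eq: "conjugation_perm G V g = conjugation_perm G V h"
  have "g \<otimes> inv h = \<one>"
  proof (rule assms(2))
    fix v assume "v \<in> V"
    then have v: "v \<in> carrier G" using assms(1) by auto
    have "conjugate_by G g v = conjugate_by G h v"
      using fun_cong [OF eq, of v] \<open>v \<in> V\<close> by (simp add: conjugation_perm_def)
    then have "conjugate_by G (g \<otimes> inv h) v = v"
      using g h v by (simp add: conjugate_by_mult conjugate_by_inv)
    then show "v \<otimes> (g \<otimes> inv h) = g \<otimes> inv h \<otimes> v"
      using g h v by (simp add: conjugate_by_fixes_iff)
  qed (use g h in auto)
  then show "g = h" using g h by (metis inv_closed inv_equality inv_inv)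
qed

end

lemma (in normal) conjugate_by_coset:
  assumes "g \<in> carrier G" "a \<in> carrier G"
  shows "conjugate_by (G Mod H) (H #> g) (H #> a) = H #> conjugate_by G g a"
proof -
  interpret Q: group "G Mod H" by (rule factorgroup_is_group)
  interpret group_hom G "G Mod H" "\<lambda>a. H #> a"
    by unfold_locales (rule r_coset_hom_Mod)
  show ?thesis using assms by (simp add: conjugate_by_def)
qed

text \<open>
  Conjugacy classes can be computed before passing to the quotient.
\<close>

lemma (in normal) conjugacy_class_coset:
  assumes "a \<in> carrier G"
  shows "conjugacy_class (G Mod H) (H #> a) = (\<lambda>x. H #> x) ` conjugacy_class G a"
  using assms
  by (simp add: conjugacy_class_def Setcompr_eq_image carrier_FactGroup image_image
      conjugate_by_coset cong: image_cong_simp)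

section \<open>Unitary matrices\<close>

lemma unitary_group_simps [simp]:
  "x \<otimes>\<^bsub>unitary_group N\<^esub> y = x * y" "\<one>\<^bsub>unitary_group N\<^esub> = 1\<^sub>m N"
  by (simp_all add: unitary_group_def)

lemma carrier_unitary_group:
  "U \<in> carrier (unitary_group N) \<longleftrightarrow>
     U \<in> carrier_mat N N \<and> U * mat_adjoint U = 1\<^sub>m N \<and> mat_adjoint U * U = 1\<^sub>m N"
  by (simp add: unitary_group_def)

lemma group_unitary_group: "group (unitary_group N)"
proof (rule groupI)
  fix U W
  assume U: "U \<in> carrier (unitary_group N)" and W: "W \<in> carrier (unitary_group N)"
  note c = U [unfolded carrier_unitary_group] W [unfolded carrier_unitary_group]
  let ?U = "mat_adjoint U" and ?W = "mat_adjoint W"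
  have U': "?U \<in> carrier_mat N N" and W': "?W \<in> carrier_mat N N"
    using c by (simp_all add: mat_adjoint_carrier)
  have "U * W * (?W * ?U) = U * (W * ?W * ?U)" "?W * ?U * (U * W) = ?W * (?U * U * W)"
    using c U' W' assoc_mult_mat [of U N N W N "?W * ?U" N] assoc_mult_mat [of W N N ?W N ?U N]
      assoc_mult_mat [of ?W N N ?U N "U * W" N] assoc_mult_mat [of ?U N N U N W N]
      mult_carrier_mat [of U N N W N] mult_carrier_mat [of ?W N N ?U N]
    by simp_all
  then have "U * W * (?W * ?U) = 1\<^sub>m N" "?W * ?U * (U * W) = 1\<^sub>m N"
    using c left_mult_one_mat [OF U'] left_mult_one_mat [of W N N] by simp_all
  moreover have "mat_adjoint (U * W) = ?W * ?U"
    using c by (intro mat_adjoint_mult) auto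
  ultimately show "U \<otimes>\<^bsub>unitary_group N\<^esub> W \<in> carrier (unitary_group N)"
    using c by (auto simp: carrier_unitary_group)
next
  fix U assume "U \<in> carrier (unitary_group N)"
  then show "\<exists>W\<in>carrier (unitary_group N). W \<otimes>\<^bsub>unitary_group N\<^esub> U = \<one>\<^bsub>unitary_group N\<^esub>"
    by (intro bexI [of _ "mat_adjoint U"]) (auto simp: carrier_unitary_group)
qed (auto simp: carrier_unitary_group intro!: assoc_mult_mat)

lemma inv_unitary_group:
  assumes "U \<in> carrier (unitary_group N)"
  shows "inv\<^bsub>unitary_group N\<^esub> U = mat_adjoint U"
  using assms
  by (intro group.inv_equality [OF group_unitary_group]) (auto simp: carrier_unitary_group)

text \<open>
  Conjugation relations are used below in the form \<open>U * A = B * U\<close>, which avoids adjoints and is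
  stable under tensor products.
\<close>

lemma unitary_intertwines_iff:
  assumes "U \<in> carrier (unitary_group N)" "A \<in> carrier_mat N N" "B \<in> carrier_mat N N"
  shows "U * A * mat_adjoint U = B \<longleftrightarrow> U * A = B * U"
proof -
  note c = assms(1) [unfolded carrier_unitary_group]
  have "B * U * mat_adjoint U = B" "U * A * mat_adjoint U * U = U * A"
    using c assms
    by (auto simp: mat_adjoint_carrier assoc_mult_mat [where n\<^sub>2 = N and n\<^sub>3 = N and n\<^sub>4 = N])
  then show ?thesis by metis
qed

lemma kron_unitary:
  assumes "U \<in> carrier (unitary_group M)" "W \<in> carrier (unitary_group N)"
  shows "U \<otimes>\<^sub>K W \<in> carrier (unitary_group (M * N))"
  using assms by (auto simp: carrier_unitary_group kron_adjoint kron_mult kron_one)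

lemma one_unitary: "1\<^sub>m N \<in> carrier (unitary_group N)"
  by (simp add: carrier_unitary_group)

lemma scalar_unitary_iff:
  assumes "N > 0"
  shows "c \<cdot>\<^sub>m 1\<^sub>m N \<in> carrier (unitary_group N) \<longleftrightarrow> c * cnj c = 1"
proof -
  have "mat_adjoint (c \<cdot>\<^sub>m 1\<^sub>m N) = cnj c \<cdot>\<^sub>m 1\<^sub>m N"
    by (rule eq_matI) auto
  moreover have "a \<cdot>\<^sub>m 1\<^sub>m N * (b \<cdot>\<^sub>m 1\<^sub>m N) = (a * b) \<cdot>\<^sub>m 1\<^sub>m N" for a b :: complex
    by (rule eq_matI) auto
  moreover have "a \<cdot>\<^sub>m 1\<^sub>m N = 1\<^sub>m N \<longleftrightarrow> a = 1" for a :: complex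
  proof
    assume "a \<cdot>\<^sub>m 1\<^sub>m N = 1\<^sub>m N"
    then have "(a \<cdot>\<^sub>m 1\<^sub>m N) $$ (0, 0) = 1\<^sub>m N $$ (0, 0)" by simp
    then show "a = 1" using assms by simp
  qed (auto intro: eq_matI)
  ultimately show ?thesis by (simp add: carrier_unitary_group mult.commute)
qed

lemma unitary_left_cancel:
  assumes "U \<in> carrier (unitary_group N)" and A: "A \<in> carrier_mat N N" and B: "B \<in> carrier_mat N N"
    and eq: "U * A = U * B"
  shows "A = B"
proof -
  have U: "U \<in> carrier_mat N N" "mat_adjoint U \<in> carrier_mat N N" "mat_adjoint U * U = 1\<^sub>m N"
    using assms(1) by (auto simp: carrier_unitary_group)
  have "mat_adjoint U * U * A = mat_adjoint U * U * B"
    using assoc_mult_mat [OF U(2,1) A] assoc_mult_mat [OF U(2,1) B] eq by simp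
  then show ?thesis using U(3) A B by simp
qed

lemma intertwine_adjoint:
  assumes "U \<in> carrier (unitary_group N)" and A: "A \<in> carrier_mat N N" and B: "B \<in> carrier_mat N N"
    and eq: "U * A = B * U"
  shows "mat_adjoint U * B = A * mat_adjoint U"
proof -
  let ?U = "mat_adjoint U"
  have U: "U \<in> carrier_mat N N" "?U \<in> carrier_mat N N" and UU: "U * ?U = 1\<^sub>m N" "?U * U = 1\<^sub>m N"
    using assms(1) by (auto simp: carrier_unitary_group)
  have "?U * B = ?U * (B * U * ?U)"
    using assoc_mult_mat [OF B U] UU(1) B by simp
  also have "\<dots> = ?U * (U * A * ?U)" by (simp only: eq)
  also have "\<dots> = ?U * (U * (A * ?U))" using assoc_mult_mat [OF U(1) A U(2)] by simp
  also have "\<dots> = ?U * U * (A * ?U)"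
    using assoc_mult_mat [OF U(2,1) mult_carrier_mat [OF A U(2)]] by simp
  also have "\<dots> = A * ?U"
    using UU(2) left_mult_one_mat [OF mult_carrier_mat [OF A U(2)]] by simp
  finally show ?thesis .
qed

lemma intertwine_mult:
  fixes U W :: "'a :: semiring_0 mat"
  assumes c: "U \<in> carrier_mat N N" "W \<in> carrier_mat N N" "A \<in> carrier_mat N N"
    "B \<in> carrier_mat N N" "C \<in> carrier_mat N N"
    and eq: "W * A = B * W" "U * B = C * U"
  shows "U * W * A = C * (U * W)"
proof -
  have "U * W * A = U * (W * A)" by (rule assoc_mult_mat [OF c(1,2,3)])
  also have "\<dots> = U * B * W" using eq assoc_mult_mat [OF c(1,4,2)] by simp
  also have "\<dots> = C * (U * W)" using eq assoc_mult_mat [OF c(5,1,2)] by simp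
  finally show ?thesis .
qed

lemma intertwine_scale:
  assumes c: "U \<in> carrier_mat N N" "A \<in> carrier_mat N N" "B \<in> carrier_mat N N"
    and eq: "U * A = (t \<cdot>\<^sub>m B) * U"
  shows "U * (s \<cdot>\<^sub>m A) = ((s * t :: complex) \<cdot>\<^sub>m B) * U"
proof -
  have "U * (s \<cdot>\<^sub>m A) = s \<cdot>\<^sub>m ((t \<cdot>\<^sub>m B) * U)"
    using mult_smult_distrib [OF c(1,2)] eq by simp
  also have "\<dots> = (s \<cdot>\<^sub>m (t \<cdot>\<^sub>m B)) * U"
    using mult_smult_assoc_mat [OF smult_carrier_mat [OF c(3)] c(1)] by simp
  finally show ?thesis by (simp only: smult_smult_mat)
qed

lemma unitary_right_cancel:
  assumes "U \<in> carrier (unitary_group N)" and A: "A \<in> carrier_mat N N" and B: "B \<in> carrier_mat N N"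
    and eq: "A * U = B * U"
  shows "A = B"
proof -
  have U: "U \<in> carrier_mat N N" "mat_adjoint U \<in> carrier_mat N N" "U * mat_adjoint U = 1\<^sub>m N"
    using assms(1) by (auto simp: carrier_unitary_group)
  have "A * (U * mat_adjoint U) = B * (U * mat_adjoint U)"
    using assoc_mult_mat [OF A U(1,2)] assoc_mult_mat [OF B U(1,2)] eq by simp
  then show ?thesis using U(3) A B by simp
qed

section \<open>The gates acting on Pauli strings\<close>

text \<open>
  The image of a Pauli matrix under conjugation by a single-qubit gate, as a sign together with a Pauli matrix.
\<close>

fun H_image :: "pauli \<Rightarrow> complex \<times> pauli" where
  "H_image PauliI = (1, PauliI)"
| "H_image PauliX = (1, PauliZ)"
| "H_image PauliY = (-1, PauliY)"
| "H_image PauliZ = (1, PauliX)"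

fun S_image :: "pauli \<Rightarrow> complex \<times> pauli" where
  "S_image PauliI = (1, PauliI)"
| "S_image PauliX = (1, PauliY)"
| "S_image PauliY = (-1, PauliX)"
| "S_image PauliZ = (1, PauliZ)"

text \<open>
  Up to phase, each Pauli matrix is \<open>X\<^sup>x Z\<^sup>z\<close> with bits \<open>x\<close> and \<open>z\<close>; \<open>has_X\<close> reads the first bit and
  \<open>flip_Z\<close> changes the second. Conjugation by \<open>CZ\<close> flips the second bit of each qubit if the first
  bit of the other one is set. A sign appears exactly for \<open>X \<otimes> Y\<close> and \<open>Y \<otimes> X\<close>.
\<close>

fun has_X :: "pauli \<Rightarrow> bool" where
  "has_X PauliI = False" | "has_X PauliX = True" | "has_X PauliY = True" | "has_X PauliZ = False"

fun flip_Z :: "pauli \<Rightarrow> pauli" where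
  "flip_Z PauliI = PauliZ" | "flip_Z PauliX = PauliY" | "flip_Z PauliY = PauliX" | "flip_Z PauliZ = PauliI"

definition CZ_sign :: "pauli \<Rightarrow> pauli \<Rightarrow> complex" where
  "CZ_sign a b = (if {a, b} = {PauliX, PauliY} then -1 else 1)"

definition CZ_image :: "pauli \<Rightarrow> pauli \<Rightarrow> pauli list" where
  "CZ_image a b = [if has_X b then flip_Z a else a, if has_X a then flip_Z b else b]"

lemma gate_H_pauli:
  "gate_H * pauli_gate q a = (fst (H_image a) \<cdot>\<^sub>m pauli_gate q (snd (H_image a))) * gate_H"
  by (cases a) (simp_all add: gate_H_def mat_2_simps)

lemma gate_S_pauli:
  assumes "\<omega> ^ 4 = -1"
  shows "gate_S \<omega> * pauli_gate (\<omega>\<^sup>2) a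
    = (fst (S_image a) \<cdot>\<^sub>m pauli_gate (\<omega>\<^sup>2) (snd (S_image a))) * gate_S \<omega>"
  using assms by (cases a) (simp_all add: gate_S_def mat_2_simps flip: power_add)

lemma gate_CZ_carrier: "gate_CZ \<in> carrier_mat 4 4"
  by (rule carrier_matI) (simp_all add: gate_CZ_def mat_of_rows_list_def)

lemma index_gate_CZ:
  "i < 4 \<Longrightarrow> j < 4 \<Longrightarrow> gate_CZ $$ (i, j) = (if i = j then if i = 3 then -1 else 1 else 0)"
  by (auto simp: gate_CZ_def mat_of_rows_list_def numeral_eq_Suc less_Suc_eq)

lemma gate_CZ_mult:
  assumes "M \<in> carrier_mat 4 4" "i < 4" "j < 4"
  shows "(gate_CZ * M) $$ (i, j) = (if i = 3 then -1 else 1) * M $$ (i, j)"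
    and "(M * gate_CZ) $$ (i, j) = (if j = 3 then -1 else 1) * M $$ (i, j)"
proof -
  have "(gate_CZ * M) $$ (i, j) = (\<Sum>k\<in>{0..<4}. gate_CZ $$ (i, k) * M $$ (k, j))"
    using assms gate_CZ_carrier by (auto simp: scalar_prod_def)
  also have "\<dots> = (\<Sum>k\<in>{0..<4}. if k = i then (if i = 3 then -1 else 1) * M $$ (i, j) else 0)"
    using assms by (intro sum.cong) (auto simp: index_gate_CZ)
  finally show "(gate_CZ * M) $$ (i, j) = (if i = 3 then -1 else 1) * M $$ (i, j)"
    using assms by simp
  have "(M * gate_CZ) $$ (i, j) = (\<Sum>k\<in>{0..<4}. M $$ (i, k) * gate_CZ $$ (k, j))"
    using assms gate_CZ_carrier by (auto simp: scalar_prod_def)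
  also have "\<dots> = (\<Sum>k\<in>{0..<4}. if k = j then (if j = 3 then -1 else 1) * M $$ (i, j) else 0)"
    using assms by (intro sum.cong) (auto simp: index_gate_CZ)
  finally show "(M * gate_CZ) $$ (i, j) = (if j = 3 then -1 else 1) * M $$ (i, j)"
    using assms by simp
qed

text \<open>
  As \<open>CZ\<close> is diagonal, with \<open>-1\<close> at the index where both bits are 1, the claim
  is an identity between individual entries of tensor products of two Pauli matrices.
\<close>

lemma gate_CZ_pauli:
  assumes "q\<^sup>2 = -1"
  shows "gate_CZ * pauli_mat q [a, b] = (CZ_sign a b \<cdot>\<^sub>m pauli_mat q (CZ_image a b)) * gate_CZ"
proof (rule eq_matI)
  have c: "pauli_mat q [a, b] \<in> carrier_mat 4 4" "pauli_mat q (CZ_image a b) \<in> carrier_mat 4 4"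
    by (auto simp: CZ_image_def)
  then show "dim_row (gate_CZ * pauli_mat q [a, b])
      = dim_row ((CZ_sign a b \<cdot>\<^sub>m pauli_mat q (CZ_image a b)) * gate_CZ)"
    "dim_col (gate_CZ * pauli_mat q [a, b])
      = dim_col ((CZ_sign a b \<cdot>\<^sub>m pauli_mat q (CZ_image a b)) * gate_CZ)"
    using gate_CZ_carrier by auto
  fix i j
  assume "i < dim_row ((CZ_sign a b \<cdot>\<^sub>m pauli_mat q (CZ_image a b)) * gate_CZ)"
    "j < dim_col ((CZ_sign a b \<cdot>\<^sub>m pauli_mat q (CZ_image a b)) * gate_CZ)"
  then have i: "i < 4" and j: "j < 4" using c gate_CZ_carrier by auto
  have entries: "pauli_mat q [a', b'] $$ (i, j)
      = pauli_gate q a' $$ (i div 2, j div 2) * pauli_gate q b' $$ (i mod 2, j mod 2)" for a' b'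
    using i j kron_one_right [of "pauli_gate q b'"] by (simp add: index_kron)
  have key: "\<forall>r\<in>{0, 1}. \<forall>s\<in>{0, 1}. \<forall>r'\<in>{0, 1}. \<forall>s'\<in>{0, 1}.
    (if r = 1 \<and> s = 1 then -1 else 1) * (pauli_gate q a $$ (r, r') * pauli_gate q b $$ (s, s'))
    = (if r' = 1 \<and> s' = 1 then -1 else 1) * (CZ_sign a b *
      (pauli_gate q (CZ_image a b ! 0) $$ (r, r') * pauli_gate q (CZ_image a b ! 1) $$ (s, s')))"
    using assms
    by (cases a; cases b; simp add: CZ_sign_def CZ_image_def mat_of_rows_list_2_index doubleton_eq_iff power2_eq_square)
  have three: "k = 3 \<longleftrightarrow> k div 2 = 1 \<and> k mod 2 = 1" for k :: nat
    by presburger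
  have "k div 2 \<in> {0, 1}" "k mod 2 \<in> {0, 1}" if "k < 4" for k :: nat
    using that by auto
  then have "(if i = 3 then -1 else 1) * pauli_mat q [a, b] $$ (i, j)
      = (if j = 3 then -1 else 1) * (CZ_sign a b * pauli_mat q (CZ_image a b) $$ (i, j))"
    using key i j unfolding three [of i] three [of j] by (auto simp only: entries CZ_image_def nth_Cons_0 nth_Cons_Suc One_nat_def)
  then show "(gate_CZ * pauli_mat q [a, b]) $$ (i, j)
      = ((CZ_sign a b \<cdot>\<^sub>m pauli_mat q (CZ_image a b)) * gate_CZ) $$ (i, j)"
    using c i j smult_carrier_mat [OF c(2), of "CZ_sign a b"] carrier_matD [OF c(2)]
    by (simp add: gate_CZ_mult del: pauli_mat.simps index_mult_mat(1))
qed

text \<open>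
  A gate acts on the tensor factors that it touches and leaves the others alone; the mixed-product rule
  transports a relation between small matrices to a relation between strings.
\<close>

lemma local_gate_on_string:
  assumes U: "U \<in> carrier_mat (2 ^ length as) (2 ^ length as)" and len: "length bs = length as"
    and local: "U * pauli_mat q as = (s \<cdot>\<^sub>m pauli_mat q bs) * U"
  shows "(1\<^sub>m (2 ^ length xs) \<otimes>\<^sub>K U \<otimes>\<^sub>K 1\<^sub>m (2 ^ length ys)) * pauli_mat q (xs @ as @ ys)
    = (s \<cdot>\<^sub>m pauli_mat q (xs @ bs @ ys)) * (1\<^sub>m (2 ^ length xs) \<otimes>\<^sub>K U \<otimes>\<^sub>K 1\<^sub>m (2 ^ length ys))"
proof -
  let ?X = "pauli_mat q xs" and ?Y = "pauli_mat q ys"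
  have "(1\<^sub>m (2 ^ length xs) \<otimes>\<^sub>K U \<otimes>\<^sub>K 1\<^sub>m (2 ^ length ys)) * pauli_mat q (xs @ as @ ys)
      = ?X \<otimes>\<^sub>K (U * pauli_mat q as) \<otimes>\<^sub>K ?Y"
    using U by (auto simp: pauli_mat_append kron_mult simp flip: kron_assoc)
  also have "\<dots> = (?X \<otimes>\<^sub>K (s \<cdot>\<^sub>m pauli_mat q bs) \<otimes>\<^sub>K ?Y)
      * (1\<^sub>m (2 ^ length xs) \<otimes>\<^sub>K U \<otimes>\<^sub>K 1\<^sub>m (2 ^ length ys))"
    using U len by (auto simp: local kron_mult)
  also have "?X \<otimes>\<^sub>K (s \<cdot>\<^sub>m pauli_mat q bs) \<otimes>\<^sub>K ?Y = s \<cdot>\<^sub>m pauli_mat q (xs @ bs @ ys)"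
    by (simp add: pauli_mat_append kron_smult_left kron_smult_right kron_assoc)
  finally show ?thesis .
qed

lemma on_qubit_on_string:
  assumes U: "U \<in> carrier_mat 2 2" and local: "U * pauli_gate q a = (s \<cdot>\<^sub>m pauli_gate q b) * U"
    and i: "length xs = i - 1" "length ys = n - i"
  shows "on_qubit n i U * pauli_mat q (xs @ a # ys) = (s \<cdot>\<^sub>m pauli_mat q (xs @ b # ys)) * on_qubit n i U"
  using local_gate_on_string [of U "[a]" "[b]" q s xs ys] U local
  by (simp add: on_qubit_def i del: One_nat_def)

lemma on_qubits_on_string:
  assumes q: "q\<^sup>2 = -1" and i: "length xs = i - 1" "length ys = n - i - 1"
  shows "on_qubits n i gate_CZ * pauli_mat q (xs @ a # b # ys)
    = (CZ_sign a b \<cdot>\<^sub>m pauli_mat q (xs @ CZ_image a b @ ys)) * on_qubits n i gate_CZ"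
  using local_gate_on_string [of gate_CZ "[a, b]" "CZ_image a b" q "CZ_sign a b" xs ys]
    gate_CZ_pauli [OF q, of a b] gate_CZ_carrier
  by (simp add: on_qubits_def i CZ_image_def del: One_nat_def pauli_mat.simps)

section \<open>The Clifford group\<close>

lemma gate_H_unitary: "gate_H \<in> carrier (unitary_group 2)"
  by (auto simp: carrier_unitary_group gate_H_def mat_2_simps simp flip: of_real_mult of_real_add
      intro!: carrier_matI)

lemma gate_CZ_unitary: "gate_CZ \<in> carrier (unitary_group 4)"
proof -
  have adj: "mat_adjoint gate_CZ = gate_CZ"
    using gate_CZ_carrier by (intro eq_matI) (auto simp: index_gate_CZ)
  have "gate_CZ * gate_CZ = 1\<^sub>m 4"
    using gate_CZ_carrier
    by (intro eq_matI) (auto simp: gate_CZ_mult [OF gate_CZ_carrier] index_gate_CZ simp del: index_mult_mat(1))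
  then show ?thesis
    using gate_CZ_carrier by (simp add: carrier_unitary_group adj)
qed

lemma on_qubit_unitary:
  assumes "U \<in> carrier (unitary_group 2)" "1 \<le> i" "i \<le> n"
  shows "on_qubit n i U \<in> carrier (unitary_group (2 ^ n))"
proof -
  have "2 ^ (i - 1) * 2 * 2 ^ (n - i) = (2 ^ n :: nat)"
    using assms(2,3) by (simp flip: power_Suc2 power_add)
  then show ?thesis
    using kron_unitary [OF kron_unitary [OF one_unitary assms(1)] one_unitary]
    unfolding on_qubit_def by metis
qed

lemma on_qubits_unitary:
  assumes "U \<in> carrier (unitary_group 4)" "1 \<le> i" "i + 1 \<le> n"
  shows "on_qubits n i U \<in> carrier (unitary_group (2 ^ n))"
proof -
  have "2 ^ (i - 1) * 4 * 2 ^ (n - i - 1) = (2 ^ (i - 1 + 2 + (n - i - 1)) :: nat)"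
    by (simp add: power_add)
  also have "i - 1 + 2 + (n - i - 1) = n" using assms by simp
  finally show ?thesis
    using kron_unitary [OF kron_unitary [OF one_unitary assms(1)] one_unitary]
    unfolding on_qubits_def by metis
qed

locale eighth_root =
  fixes \<omega> :: complex
  assumes root: "primitive_root_of_unity 8 \<omega>"
begin

lemmas root_simps = primitive_8th_root [OF root]

lemma gate_S_unitary: "gate_S \<omega> \<in> carrier (unitary_group 2)"
proof -
  have "\<omega>\<^sup>2 * cnj (\<omega>\<^sup>2) = (\<omega> * cnj \<omega>)\<^sup>2"
    by (simp add: power_mult_distrib)
  then have "\<omega>\<^sup>2 * cnj (\<omega>\<^sup>2) = 1"
    using root_simps(5) by (simp add: complex_norm_square [symmetric])
  then show ?thesis
    by (auto simp: carrier_unitary_group gate_S_def mat_2_simps mult.commute intro!: carrier_matI)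
qed

lemma scalar_root_unitary: "\<omega> \<cdot>\<^sub>m 1\<^sub>m (2 ^ n) \<in> carrier (unitary_group (2 ^ n))"
proof -
  have "\<omega> * cnj \<omega> = 1"
    using root_simps(5) by (simp add: complex_norm_square [symmetric])
  then show ?thesis by (simp add: scalar_unitary_iff)
qed

lemma clifford_gens_unitary: "clifford_gens \<omega> n \<subseteq> carrier (unitary_group (2 ^ n))"
  unfolding clifford_gens_def
  using scalar_root_unitary on_qubit_unitary [OF gate_H_unitary] on_qubit_unitary [OF gate_S_unitary]
    on_qubits_unitary [OF gate_CZ_unitary]
  by auto

lemma carrier_clifford:
  "carrier (clifford \<omega> n) = generate (opposite (unitary_group (2 ^ n))) (clifford_gens \<omega> n)"
  using clifford_gens_unitary [of n]
  by (simp add: clifford_def carrier_subgroup_generated Int_absorb1)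

lemma clifford_unitary: "U \<in> carrier (clifford \<omega> n) \<Longrightarrow> U \<in> carrier (unitary_group (2 ^ n))"
  using group.carrier_subgroup_generated_subset [OF group.group_opposite [OF group_unitary_group]]
  by (auto simp: clifford_def)

lemma clifford_carrier_mat: "U \<in> carrier (clifford \<omega> n) \<Longrightarrow> U \<in> carrier_mat (2 ^ n) (2 ^ n)"
  using clifford_unitary carrier_unitary_group by blast

lemma clifford_simps [simp]:
  "x \<otimes>\<^bsub>clifford \<omega> n\<^esub> y = y * x" "\<one>\<^bsub>clifford \<omega> n\<^esub> = 1\<^sub>m (2 ^ n)"
  by (simp_all add: clifford_def)

lemma group_clifford: "group (clifford \<omega> n)"
  unfolding clifford_def
  by (rule group.group_subgroup_generated [OF group.group_opposite [OF group_unitary_group]])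

lemma inv_clifford: "U \<in> carrier (clifford \<omega> n) \<Longrightarrow> inv\<^bsub>clifford \<omega> n\<^esub> U = mat_adjoint U"
  using clifford_unitary [of U n]
  by (simp add: clifford_def group.inv_subgroup_generated [OF group.group_opposite [OF group_unitary_group]]
      group.inv_opposite [OF group_unitary_group] inv_unitary_group)

lemma clifford_gens_in_clifford: "U \<in> clifford_gens \<omega> n \<Longrightarrow> U \<in> carrier (clifford \<omega> n)"
  by (simp add: carrier_clifford generate.incl)

text \<open>
  Inverses enter the generated group only as inverses of generators, so it is enough
  to treat adjoints of generators, with the property already known for the generator itself.
\<close>

lemma clifford_induct [consumes 1, case_names one gen adjoint mult]:
  assumes "U \<in> carrier (clifford \<omega> n)"
    and "P (1\<^sub>m (2 ^ n))"
    and "\<And>U. U \<in> clifford_gens \<omega> n \<Longrightarrow> P U"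
    and "\<And>U. U \<in> clifford_gens \<omega> n \<Longrightarrow> P U \<Longrightarrow> P (mat_adjoint U)"
    and "\<And>U W. U \<in> carrier (clifford \<omega> n) \<Longrightarrow> W \<in> carrier (clifford \<omega> n) \<Longrightarrow> P U \<Longrightarrow> P W \<Longrightarrow> P (U * W)"
  shows "P U"
proof -
  have "U \<in> generate (opposite (unitary_group (2 ^ n))) (clifford_gens \<omega> n)"
    using assms(1) by (simp add: carrier_clifford)
  then show ?thesis
  proof induction
    case one
    then show ?case using assms(2) by simp
  next
    case (incl h)
    then show ?case by (rule assms(3))
  next
    case (inv h)
    then have "inv\<^bsub>opposite (unitary_group (2 ^ n))\<^esub> h = mat_adjoint h"
      using clifford_gens_unitary [of n]
      by (auto simp: group.inv_opposite [OF group_unitary_group] inv_unitary_group)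
    then show ?case using inv assms(3,4) by simp
  next
    case (eng h1 h2)
    then show ?case using assms(5) [of h2 h1] by (simp add: carrier_clifford)
  qed
qed

section \<open>Cliffords permute the signed Paulis\<close>

abbreviation "pauli_op \<equiv> pauli_mat (\<omega>\<^sup>2)"

definition signed_paulis :: "nat \<Rightarrow> complex mat set" where
  "signed_paulis n =
     {s \<cdot>\<^sub>m pauli_op p | s p. s \<in> {1, -1} \<and> length p = n \<and> p \<noteq> replicate n PauliI}"

lemma signed_paulis_carrier: "P \<in> signed_paulis n \<Longrightarrow> P \<in> carrier_mat (2 ^ n) (2 ^ n)"
  by (auto simp: signed_paulis_def)

lemma signed_pauli_eq_iff:
  assumes "length p = n" "length r = n" "s \<noteq> 0"
  shows "s \<cdot>\<^sub>m pauli_op p = t \<cdot>\<^sub>m pauli_op r \<longleftrightarrow> s = t \<and> p = r"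
proof
  assume eq: "s \<cdot>\<^sub>m pauli_op p = t \<cdot>\<^sub>m pauli_op r"
  have tr: "trace (u \<cdot>\<^sub>m pauli_op x * pauli_op p) = u * (if x = p then 2 ^ n else 0)" if "length x = n" for u x
  proof -
    have "u \<cdot>\<^sub>m pauli_op x * pauli_op p = u \<cdot>\<^sub>m (pauli_op x * pauli_op p)"
      using that assms(1) by (intro mult_smult_assoc_mat) (auto intro: pauli_mat_carrier)
    moreover have "pauli_op x * pauli_op p \<in> carrier_mat (2 ^ n) (2 ^ n)"
      using that assms(1) by (auto intro: pauli_mat_carrier)
    ultimately show ?thesis
      using trace_pauli_mult [OF root_simps(4), of x p] that assms(1) by (simp add: trace_smult)
  qed
  have "s * 2 ^ n = t * (if r = p then 2 ^ n else 0)"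
    using tr [OF assms(1), of s] tr [OF assms(2), of t] eq by simp
  then show "s = t \<and> p = r" using assms(3) by (auto split: if_splits)
qed simp

lemma finite_signed_paulis: "finite (signed_paulis n)"
  and card_signed_paulis: "card (signed_paulis n) = 2 * (4 ^ n - 1)"
proof -
  let ?S = "{p. length p = n} - {replicate n PauliI}"
  have eq: "signed_paulis n = (\<lambda>(s, p). s \<cdot>\<^sub>m pauli_op p) ` ({1, -1} \<times> ?S)"
    by (auto simp: signed_paulis_def image_iff)
  have "finite ?S" "card ?S = 4 ^ n - 1"
    using finite_pauli_strings [of n] card_pauli_strings [of n] by (auto simp: card_Diff_singleton)
  moreover have "inj_on (\<lambda>(s, p). s \<cdot>\<^sub>m pauli_op p) ({1, -1} \<times> ?S)"
  proof (rule inj_onI)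
    fix x y
    assume x: "x \<in> {1, -1} \<times> ?S" and y: "y \<in> {1, -1} \<times> ?S"
      and eq: "(case x of (s, p) \<Rightarrow> s \<cdot>\<^sub>m pauli_op p) = (case y of (s, p) \<Rightarrow> s \<cdot>\<^sub>m pauli_op p)"
    have "fst x \<noteq> 0" "length (snd x) = n" "length (snd y) = n" using x y by auto
    then show "x = y"
      using eq signed_pauli_eq_iff [of "snd x" n "snd y" "fst x" "fst y"]
      by (simp add: case_prod_unfold prod_eq_iff)
  qed
  ultimately show "finite (signed_paulis n)" "card (signed_paulis n) = 2 * (4 ^ n - 1)"
    unfolding eq by (simp_all add: card_image card_cartesian_product)
qed

lemma trace_signed_pauli:
  assumes "P \<in> signed_paulis n"
  shows "trace P = 0"
proof -
  obtain s p where P: "P = s \<cdot>\<^sub>m pauli_op p" "length p = n" "p \<noteq> replicate n PauliI"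
    using assms by (auto simp: signed_paulis_def)
  have c: "pauli_op p \<in> carrier_mat (2 ^ n) (2 ^ n)" using P(2) by (rule pauli_mat_carrier)
  have "trace (pauli_op p * pauli_op (replicate n PauliI)) = 0"
    using P by (simp add: trace_pauli_mult root_simps)
  then have "trace (pauli_op p) = 0"
    using right_mult_one_mat [OF c] by (simp add: pauli_mat_identity)
  then show ?thesis using c by (simp add: P(1) trace_smult)
qed

lemma not_identity_string_iff:
  "length p = n \<Longrightarrow> p \<noteq> replicate n PauliI \<longleftrightarrow> (\<exists>a\<in>set p. a \<noteq> PauliI)"
  by (metis in_set_replicate replicate_eqI)

lemma signed_paulis_iff:
  "P \<in> signed_paulis n \<longleftrightarrow>
     (\<exists>s p. P = s \<cdot>\<^sub>m pauli_op p \<and> s \<in> {1, -1} \<and> length p = n \<and> (\<exists>a\<in>set p. a \<noteq> PauliI))"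
  unfolding signed_paulis_def mem_Collect_eq
  by (simp only: not_identity_string_iff cong: conj_cong)

text \<open>
  Each gate changes at most two adjacent tensor factors and at most the sign. That the string does not
  become the identity is visible on these factors: the gate permutes their values and fixes the identity.
\<close>

lemma generator_maps_signed_paulis:
  assumes U: "U \<in> clifford_gens \<omega> n" and P: "P \<in> signed_paulis n"
  shows "\<exists>Q\<in>signed_paulis n. U * P = Q * U"
proof -
  obtain s p where P_eq: "P = s \<cdot>\<^sub>m pauli_op p" and s: "s \<in> {1, -1}" and len: "length p = n"
    and nontriv: "\<exists>a\<in>set p. a \<noteq> PauliI"
    using P unfolding signed_paulis_iff by blast
  have U': "U \<in> carrier_mat (2 ^ n) (2 ^ n)"
    using U by (intro clifford_carrier_mat clifford_gens_in_clifford)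
  have lift: ?thesis if "U * pauli_op p = (t \<cdot>\<^sub>m pauli_op r) * U" "t \<in> {1, -1}" "length r = n" "\<exists>a\<in>set r. a \<noteq> PauliI"
    for t r
  proof
    have c: "pauli_op p \<in> carrier_mat (2 ^ n) (2 ^ n)" "pauli_op r \<in> carrier_mat (2 ^ n) (2 ^ n)"
      using len that by (auto intro: pauli_mat_carrier)
    show "U * P = ((s * t) \<cdot>\<^sub>m pauli_op r) * U"
      unfolding P_eq by (rule intertwine_scale [OF U' c that(1)])
    have "s * t \<in> {1, -1}" using s that(2) by auto
    then show "(s * t) \<cdot>\<^sub>m pauli_op r \<in> signed_paulis n"
      using that(3,4) unfolding signed_paulis_iff by blast
  qed
  have single: "\<exists>xs a ys. p = xs @ a # ys \<and> length xs = i - 1 \<and> length ys = n - i"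
    if "1 \<le> i" "i \<le> n" for i
    using id_take_nth_drop [of "i - 1" p] len that
    by (intro exI [of _ "take (i - 1) p"] exI [of _ "p ! (i - 1)"] exI [of _ "drop i p"]) auto
  have double: "\<exists>xs a b ys. p = xs @ a # b # ys \<and> length xs = i - 1 \<and> length ys = n - i - 1"
    if "1 \<le> i" "i + 1 \<le> n" for i
    using id_take_nth_drop [of "i - 1" p] Cons_nth_drop_Suc [of i p] len that
    by (intro exI [of _ "take (i - 1) p"] exI [of _ "p ! (i - 1)"] exI [of _ "p ! i"]
        exI [of _ "drop (Suc i) p"]) auto
  from U consider "U = \<omega> \<cdot>\<^sub>m 1\<^sub>m (2 ^ n)"
    | i where "1 \<le> i" "i \<le> n" "U = on_qubit n i gate_H"
    | i where "1 \<le> i" "i \<le> n" "U = on_qubit n i (gate_S \<omega>)"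
    | i where "1 \<le> i" "i + 1 \<le> n" "U = on_qubits n i gate_CZ"
    unfolding clifford_gens_def by blast
  then show ?thesis
  proof cases
    case 1
    have c: "P \<in> carrier_mat (2 ^ n) (2 ^ n)" using P by (rule signed_paulis_carrier)
    have "U * P = P * U"
      unfolding 1 using c mult_smult_distrib [OF c one_carrier_mat] by (simp add: mult_smult_assoc_mat [OF one_carrier_mat c])
    then show ?thesis using P by blast
  next
    case 2
    obtain xs a ys where p: "p = xs @ a # ys" "length xs = i - 1" "length ys = n - i"
      using single [OF 2(1,2)] by blast
    let ?r = "xs @ snd (H_image a) # ys"
    have "gate_H \<in> carrier_mat 2 2" using gate_H_unitary by (simp add: carrier_unitary_group)
    then have "U * pauli_op p = (fst (H_image a) \<cdot>\<^sub>m pauli_op ?r) * U"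
      unfolding 2(3) p(1) by (rule on_qubit_on_string [OF _ gate_H_pauli p(2,3)])
    moreover have "fst (H_image a) \<in> {1, -1}" by (cases a) auto
    moreover have "length ?r = n" using len p by simp
    moreover have "\<exists>b\<in>set ?r. b \<noteq> PauliI" using nontriv p by (cases a) auto
    ultimately show ?thesis by (rule lift)
  next
    case 3
    obtain xs a ys where p: "p = xs @ a # ys" "length xs = i - 1" "length ys = n - i"
      using single [OF 3(1,2)] by blast
    let ?r = "xs @ snd (S_image a) # ys"
    have "gate_S \<omega> \<in> carrier_mat 2 2" using gate_S_unitary by (simp add: carrier_unitary_group)
    then have "U * pauli_op p = (fst (S_image a) \<cdot>\<^sub>m pauli_op ?r) * U"
      unfolding 3(3) p(1) by (rule on_qubit_on_string [OF _ gate_S_pauli [OF root_simps(1)] p(2,3)])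
    moreover have "fst (S_image a) \<in> {1, -1}" by (cases a) auto
    moreover have "length ?r = n" using len p by simp
    moreover have "\<exists>b\<in>set ?r. b \<noteq> PauliI" using nontriv p by (cases a) auto
    ultimately show ?thesis by (rule lift)
  next
    case 4
    obtain xs a b ys where p: "p = xs @ a # b # ys" "length xs = i - 1" "length ys = n - i - 1"
      using double [OF 4(1,2)] by blast
    let ?r = "xs @ CZ_image a b @ ys"
    have "U * pauli_op p = (CZ_sign a b \<cdot>\<^sub>m pauli_op ?r) * U"
      unfolding 4(3) p(1) by (rule on_qubits_on_string [OF root_simps(4) p(2,3)])
    moreover have "CZ_sign a b \<in> {1, -1}" by (simp add: CZ_sign_def)
    moreover have "length ?r = n" using len p by (simp add: CZ_image_def)
    moreover have "\<exists>c\<in>set ?r. c \<noteq> PauliI"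
      using nontriv p by (cases a; cases b) (auto simp: CZ_image_def)
    ultimately show ?thesis by (rule lift)
  qed
qed

text \<open>
  The adjoint case uses finiteness: a generator acts injectively on a finite set, hence
  surjectively, so its inverse preserves the set too.
\<close>

lemma clifford_maps_signed_paulis:
  assumes "U \<in> carrier (clifford \<omega> n)" "P \<in> signed_paulis n"
  shows "\<exists>Q\<in>signed_paulis n. U * P = Q * U"
  using assms
proof (induction arbitrary: P rule: clifford_induct)
  case one
  then show ?case
    using signed_paulis_carrier [of P n] by (intro bexI [of _ P]) simp_all
next
  case (gen U)
  then show ?case by (rule generator_maps_signed_paulis)
next
  case (adjoint U)
  have cl: "U \<in> carrier (clifford \<omega> n)" using adjoint(1) by (rule clifford_gens_in_clifford)
  note U = clifford_unitary [OF cl]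
  obtain f where f: "\<And>Q. Q \<in> signed_paulis n \<Longrightarrow> f Q \<in> signed_paulis n \<and> U * Q = f Q * U"
    using adjoint(2) by metis
  have "inj_on f (signed_paulis n)"
    using f unitary_left_cancel [OF U] signed_paulis_carrier by (metis inj_onI)
  then have "f ` signed_paulis n = signed_paulis n"
    using f by (intro endo_inj_surj finite_signed_paulis) auto
  then obtain Q where Q: "Q \<in> signed_paulis n" "U * Q = P * U"
    using adjoint(3) f by (metis imageE)
  have c: "P \<in> carrier_mat (2 ^ n) (2 ^ n)" "Q \<in> carrier_mat (2 ^ n) (2 ^ n)"
    using Q adjoint by (auto intro: signed_paulis_carrier)
  show ?case using intertwine_adjoint [OF U c(2,1) Q(2)] Q(1) by blast
next
  case (mult U W)
  obtain Q where Q: "Q \<in> signed_paulis n" "W * P = Q * W" using mult by blast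
  obtain R where R: "R \<in> signed_paulis n" "U * Q = R * U" using mult Q by blast
  have c: "U \<in> carrier_mat (2 ^ n) (2 ^ n)" "W \<in> carrier_mat (2 ^ n) (2 ^ n)" "P \<in> carrier_mat (2 ^ n) (2 ^ n)"
    "Q \<in> carrier_mat (2 ^ n) (2 ^ n)" "R \<in> carrier_mat (2 ^ n) (2 ^ n)"
    using mult Q R by (auto intro: signed_paulis_carrier clifford_carrier_mat)
  show ?case using intertwine_mult [OF c Q(2) R(2)] R(1) by blast
qed

section \<open>Transitivity on the signed Paulis\<close>

text \<open>
  Being in the same orbit under conjugation by Cliffords. The dimensions are part of the definition because
  matrix multiplication is associative only for matching dimensions.
\<close>

definition clifford_conj :: "nat \<Rightarrow> complex mat \<Rightarrow> complex mat \<Rightarrow> bool" where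
  "clifford_conj n P Q \<longleftrightarrow> P \<in> carrier_mat (2 ^ n) (2 ^ n) \<and> Q \<in> carrier_mat (2 ^ n) (2 ^ n)
     \<and> (\<exists>U\<in>carrier (clifford \<omega> n). U * P = Q * U)"

lemma clifford_conj_refl: "P \<in> carrier_mat (2 ^ n) (2 ^ n) \<Longrightarrow> clifford_conj n P P"
  using monoid.one_closed [OF group.is_monoid [OF group_clifford], of n]
  unfolding clifford_conj_def by (intro conjI bexI [of _ "1\<^sub>m (2 ^ n)"]) simp_all

lemma clifford_conj_trans:
  assumes "clifford_conj n P Q" "clifford_conj n Q R"
  shows "clifford_conj n P R"
proof -
  obtain U W where U: "U \<in> carrier (clifford \<omega> n)" "U * P = Q * U"
    and W: "W \<in> carrier (clifford \<omega> n)" "W * Q = R * W"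
    using assms by (auto simp: clifford_conj_def)
  have c: "W \<in> carrier_mat (2 ^ n) (2 ^ n)" "U \<in> carrier_mat (2 ^ n) (2 ^ n)" "P \<in> carrier_mat (2 ^ n) (2 ^ n)"
    "Q \<in> carrier_mat (2 ^ n) (2 ^ n)" "R \<in> carrier_mat (2 ^ n) (2 ^ n)"
    using assms U W by (auto simp: clifford_conj_def intro: clifford_carrier_mat)
  have "W * U * P = R * (W * U)" by (rule intertwine_mult [OF c U(2) W(2)])
  moreover have "W * U \<in> carrier (clifford \<omega> n)"
    using monoid.m_closed [OF group.is_monoid [OF group_clifford] U(1) W(1)] by simp
  ultimately show ?thesis using c unfolding clifford_conj_def by blast
qed

lemma clifford_conj_sym:
  assumes "clifford_conj n P Q"
  shows "clifford_conj n Q P"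
proof -
  obtain U where U: "U \<in> carrier (clifford \<omega> n)" "U * P = Q * U"
    using assms by (auto simp: clifford_conj_def)
  have c: "P \<in> carrier_mat (2 ^ n) (2 ^ n)" "Q \<in> carrier_mat (2 ^ n) (2 ^ n)"
    using assms by (auto simp: clifford_conj_def)
  have "mat_adjoint U * Q = P * mat_adjoint U"
    by (rule intertwine_adjoint [OF clifford_unitary [OF U(1)] c U(2)])
  moreover have "mat_adjoint U \<in> carrier (clifford \<omega> n)"
    using group.inv_closed [OF group_clifford U(1)] by (simp add: inv_clifford U(1))
  ultimately show ?thesis using c unfolding clifford_conj_def by blast
qed

lemma clifford_conj_scale:
  assumes U: "U \<in> carrier (clifford \<omega> n)" and "length p = n" "length r = n"
    and eq: "U * pauli_op p = (t \<cdot>\<^sub>m pauli_op r) * U"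
  shows "clifford_conj n (s \<cdot>\<^sub>m pauli_op p) ((s * t) \<cdot>\<^sub>m pauli_op r)"
proof -
  have c: "U \<in> carrier_mat (2 ^ n) (2 ^ n)" "pauli_op p \<in> carrier_mat (2 ^ n) (2 ^ n)" "pauli_op r \<in> carrier_mat (2 ^ n) (2 ^ n)"
    using assms by (auto intro: pauli_mat_carrier clifford_carrier_mat)
  show ?thesis
    unfolding clifford_conj_def
    using intertwine_scale [OF c eq, of s] U smult_carrier_mat [OF c(2)] smult_carrier_mat [OF c(3)] by blast
qed

lemma conj_H:
  assumes "length xs + Suc (length ys) = n"
  shows "clifford_conj n (s \<cdot>\<^sub>m pauli_op (xs @ a # ys)) ((s * fst (H_image a)) \<cdot>\<^sub>m pauli_op (xs @ snd (H_image a) # ys))"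
proof (rule clifford_conj_scale)
  let ?i = "Suc (length xs)"
  show "on_qubit n ?i gate_H \<in> carrier (clifford \<omega> n)"
    using assms by (intro clifford_gens_in_clifford) (auto simp: clifford_gens_def)
  have "gate_H \<in> carrier_mat 2 2" using gate_H_unitary by (simp add: carrier_unitary_group)
  then show "on_qubit n ?i gate_H * pauli_op (xs @ a # ys)
      = (fst (H_image a) \<cdot>\<^sub>m pauli_op (xs @ snd (H_image a) # ys)) * on_qubit n ?i gate_H"
    using assms by (intro on_qubit_on_string gate_H_pauli) auto
qed (use assms in auto)

lemma conj_S:
  assumes "length xs + Suc (length ys) = n"
  shows "clifford_conj n (s \<cdot>\<^sub>m pauli_op (xs @ a # ys)) ((s * fst (S_image a)) \<cdot>\<^sub>m pauli_op (xs @ snd (S_image a) # ys))"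
proof (rule clifford_conj_scale)
  let ?i = "Suc (length xs)"
  show "on_qubit n ?i (gate_S \<omega>) \<in> carrier (clifford \<omega> n)"
    using assms by (intro clifford_gens_in_clifford) (auto simp: clifford_gens_def)
  have "gate_S \<omega> \<in> carrier_mat 2 2" using gate_S_unitary by (simp add: carrier_unitary_group)
  then show "on_qubit n ?i (gate_S \<omega>) * pauli_op (xs @ a # ys)
      = (fst (S_image a) \<cdot>\<^sub>m pauli_op (xs @ snd (S_image a) # ys)) * on_qubit n ?i (gate_S \<omega>)"
    using assms by (intro on_qubit_on_string gate_S_pauli root_simps) auto
qed (use assms in auto)

lemma conj_CZ:
  assumes "length xs + Suc (Suc (length ys)) = n"
  shows "clifford_conj n (s \<cdot>\<^sub>m pauli_op (xs @ a # b # ys)) ((s * CZ_sign a b) \<cdot>\<^sub>m pauli_op (xs @ CZ_image a b @ ys))"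
proof (rule clifford_conj_scale)
  let ?i = "Suc (length xs)"
  show "on_qubits n ?i gate_CZ \<in> carrier (clifford \<omega> n)"
    using assms by (intro clifford_gens_in_clifford) (auto simp: clifford_gens_def)
  show "on_qubits n ?i gate_CZ * pauli_op (xs @ a # b # ys)
      = (CZ_sign a b \<cdot>\<^sub>m pauli_op (xs @ CZ_image a b @ ys)) * on_qubits n ?i gate_CZ"
    using assms by (intro on_qubits_on_string root_simps) auto
qed (use assms in \<open>auto simp: CZ_image_def\<close>)

text \<open>
  \<open>H\<close> links \<open>X\<close> and \<open>Z\<close>, and \<open>S\<close> links \<open>X\<close> and \<open>Y\<close>. Two applications of \<open>S\<close> send \<open>X\<close> to \<open>-X\<close>, so
  the sign is free as well.
\<close>

lemma conj_local:
  assumes len: "length xs + Suc (length ys) = n" and "a \<noteq> PauliI" "b \<noteq> PauliI" "s \<in> {1, -1}" "t \<in> {1, -1}"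
  shows "clifford_conj n (s \<cdot>\<^sub>m pauli_op (xs @ a # ys)) (t \<cdot>\<^sub>m pauli_op (xs @ b # ys))"
proof -
  let ?P = "\<lambda>s a. s \<cdot>\<^sub>m pauli_op (xs @ a # ys)"
  have XZ: "clifford_conj n (?P s PauliX) (?P s PauliZ)" and XY: "clifford_conj n (?P s PauliX) (?P s PauliY)"
    and YX: "clifford_conj n (?P s PauliY) (?P (-s) PauliX)" for s
    using conj_H [OF len, of s PauliX] conj_S [OF len, of s PauliX] conj_S [OF len, of s PauliY] by simp_all
  have from_X: "clifford_conj n (?P s PauliX) (?P t c)" if "c \<noteq> PauliI" "s \<in> {1, -1}" "t \<in> {1, -1}" for s t c
  proof -
    have "clifford_conj n (?P s PauliX) (?P (-s) PauliX)"
      using clifford_conj_trans [OF XY YX] .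
    moreover have "clifford_conj n (?P s PauliX) (?P s PauliX)"
      using len by (intro clifford_conj_refl smult_carrier_mat pauli_mat_carrier) simp
    ultimately have "clifford_conj n (?P s PauliX) (?P t PauliX)"
      using that by auto
    moreover have "clifford_conj n (?P t PauliX) (?P t c)"
    proof (cases c)
      case PauliX
      then show ?thesis
        using len by (auto intro!: clifford_conj_refl smult_carrier_mat pauli_mat_carrier)
    qed (use that XY XZ in auto)
    ultimately show ?thesis by (rule clifford_conj_trans)
  qed
  show ?thesis
    using clifford_conj_trans [OF clifford_conj_sym [OF from_X [of a 1 s]] from_X [of b 1 t]] assms
    by simp
qed

text \<open>
  Induction on the string, sweeping its support to the left. If the rest \<open>q\<close> of the string is the
  identity, a local move suffices. Otherwise the induction hypothesis, applied with the first letter moved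
  into the untouched prefix, leaves at most two letters that are not the identity, in the first
  two positions. A \<open>CZ\<close> then erases the second one, after it has been used to create a first one if
  there was none.
\<close>

lemma conj_to_Z:
  assumes "length xs + length q = n" "\<exists>a\<in>set q. a \<noteq> PauliI" "s \<in> {1, -1}" "t \<in> {1, -1}"
  shows "clifford_conj n (s \<cdot>\<^sub>m pauli_op (xs @ q)) (t \<cdot>\<^sub>m pauli_op (xs @ PauliZ # replicate (length q - 1) PauliI))"
  using assms
proof (induction q arbitrary: xs s)
  case Nil
  then show ?case by simp
next
  case (Cons a q)
  show ?case
  proof (cases "\<exists>b\<in>set q. b \<noteq> PauliI")
    case False
    then have "q = replicate (length q) PauliI" by (metis replicate_length_same)
    moreover have "a \<noteq> PauliI" using False Cons.prems by auto
    ultimately show ?thesis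
      using conj_local [of xs q n a PauliZ s t] Cons.prems by simp
  next
    case True
    then obtain m where m: "length q = Suc m" by (cases q) auto
    let ?r = "replicate m PauliI"
    let ?P = "\<lambda>t a b. t \<cdot>\<^sub>m pauli_op (xs @ a # b # ?r)"
    have len: "length xs + Suc (Suc (length ?r)) = n" "length (xs @ [c]) + Suc (length ?r) = n"
      "length xs + Suc (length (c # ?r)) = n" for c
      using Cons.prems m by auto
    have first: "clifford_conj n (?P t a c) (?P t' b c)"
      if "a \<noteq> PauliI" "b \<noteq> PauliI" "t \<in> {1, -1}" "t' \<in> {1, -1}" for a b c t t'
      using conj_local [OF len(3) that] .
    have second: "clifford_conj n (?P t c a) (?P t' c b)"
      if "a \<noteq> PauliI" "b \<noteq> PauliI" "t \<in> {1, -1}" "t' \<in> {1, -1}" for a b c t t'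
      using conj_local [OF len(2) that, of c] by simp
    have XI: "clifford_conj n (?P t PauliX PauliI) (?P t PauliX PauliZ)"
      and IX: "clifford_conj n (?P t PauliI PauliX) (?P t PauliZ PauliX)" for t
      using conj_CZ [OF len(1), of t PauliX PauliI] conj_CZ [OF len(1), of t PauliI PauliX]
      by (simp_all add: CZ_sign_def CZ_image_def doubleton_eq_iff)
    \<comment> \<open>The second letter \<open>Z\<close> is erased by \<open>CZ\<close>, once the first letter is \<open>X\<close>.\<close>
    have both: "clifford_conj n (?P 1 c PauliZ) (?P t PauliZ PauliI)" if "c \<noteq> PauliI" for c
      using clifford_conj_trans [OF first clifford_conj_trans [OF clifford_conj_sym [OF XI] first]]
        that Cons.prems(4) by (metis insertCI pauli.distinct(1,5))
    have "clifford_conj n (?P 1 a PauliZ) (?P t PauliZ PauliI)"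
    proof (cases "a = PauliI")
      case True
      \<comment> \<open>There is no first letter yet: turn the second one into \<open>X\<close>, so that \<open>CZ\<close> creates a \<open>Z\<close> to its left.\<close>
      have "clifford_conj n (?P 1 PauliI PauliZ) (?P 1 PauliI PauliX)"
        "clifford_conj n (?P 1 PauliZ PauliX) (?P 1 PauliZ PauliZ)"
        by (rule second; simp)+
      then show ?thesis
        unfolding True using IX both [of PauliZ] clifford_conj_trans by blast
    qed (rule both)
    moreover have "clifford_conj n (s \<cdot>\<^sub>m pauli_op (xs @ a # q)) (?P 1 a PauliZ)"
    proof -
      have "clifford_conj n (s \<cdot>\<^sub>m pauli_op ((xs @ [a]) @ q)) (t \<cdot>\<^sub>m pauli_op ((xs @ [a]) @ PauliZ # replicate (length q - 1) PauliI))"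
        using True Cons.prems by (intro Cons.IH) auto
      then have "clifford_conj n (s \<cdot>\<^sub>m pauli_op (xs @ a # q)) (?P t a PauliZ)"
        by (simp add: m)
      moreover have "clifford_conj n (?P t a PauliZ) (?P 1 a PauliZ)"
        using Cons.prems by (intro second) auto
      ultimately show ?thesis by (rule clifford_conj_trans)
    qed
    ultimately show ?thesis
      using clifford_conj_trans by (fastforce simp: m)
  qed
qed

lemma clifford_transitive:
  assumes "P \<in> signed_paulis n" "n \<ge> 1"
  shows "clifford_conj n (1 \<cdot>\<^sub>m pauli_op (PauliZ # replicate (n - 1) PauliI)) P"
proof -
  obtain s p where P: "P = s \<cdot>\<^sub>m pauli_op p" and p: "s \<in> {1, -1}" "length p = n" "\<exists>a\<in>set p. a \<noteq> PauliI"
    using assms(1) unfolding signed_paulis_iff by blast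
  have "clifford_conj n (s \<cdot>\<^sub>m pauli_op ([] @ p)) (1 \<cdot>\<^sub>m pauli_op ([] @ PauliZ # replicate (length p - 1) PauliI))"
    by (rule conj_to_Z) (use p in simp_all)
  then show ?thesis
    unfolding P append_Nil p(2) by (rule clifford_conj_sym)
qed

end

section \<open>Scalars in the Clifford group\<close>

definition entries_in :: "'a set \<Rightarrow> 'a mat \<Rightarrow> bool" where
  "entries_in R A \<longleftrightarrow> (\<forall>i<dim_row A. \<forall>j<dim_col A. A $$ (i, j) \<in> R)"

lemma entries_in_mat_of_rows_list_2:
  "entries_in R (mat_of_rows_list 2 [[a, b], [c, d]]) \<longleftrightarrow> a \<in> R \<and> b \<in> R \<and> c \<in> R \<and> d \<in> R"
  by (auto simp: entries_in_def mat_of_rows_list_2_index less_2_cases_iff)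

context eighth_root
begin

lemma kron_entries:
  assumes "entries_in (gate_ring \<omega>) A" "entries_in (gate_ring \<omega>) B"
  shows "entries_in (gate_ring \<omega>) (A \<otimes>\<^sub>K B)"
  using assms unfolding entries_in_def
  by (auto simp: index_kron div_mod_bound intro!: gate_ring_mult root_simps)

lemma one_entries: "entries_in (gate_ring \<omega>) (1\<^sub>m N)"
  by (auto simp: entries_in_def gate_ring_basic)

lemma mult_entries:
  assumes "entries_in (gate_ring \<omega>) A" "entries_in (gate_ring \<omega>) B" "dim_col A = dim_row B"
  shows "entries_in (gate_ring \<omega>) (A * B)"
  using assms unfolding entries_in_def
  by (auto simp: scalar_prod_def intro!: gate_ring_sum gate_ring_mult root_simps)

lemma adjoint_entries:
  assumes "entries_in (gate_ring \<omega>) A"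
  shows "entries_in (gate_ring \<omega>) (mat_adjoint A)"
  using assms unfolding entries_in_def by (auto intro: gate_ring_cnj root)

text \<open>
  All gates have entries in \<^term>\<open>gate_ring \<omega>\<close>, and this ring is closed under complex conjugation, so
  taking adjoints does not leave it.
\<close>

lemma clifford_entries:
  assumes "U \<in> carrier (clifford \<omega> n)"
  shows "entries_in (gate_ring \<omega>) U"
  using assms
proof (induction rule: clifford_induct)
  case one
  show ?case by (rule one_entries)
next
  case (gen U)
  note basic = gate_ring_basic [of \<omega>] inverse_sqrt_2_in_gate_ring [OF root]
  have "entries_in (gate_ring \<omega>) gate_H"
    using basic gate_ring_uminus [OF root_simps(1) basic(6)]
    by (simp add: gate_H_def smult_mat_of_rows_list_2 entries_in_mat_of_rows_list_2)
  moreover have "entries_in (gate_ring \<omega>) (gate_S \<omega>)"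
    using basic by (simp add: gate_S_def entries_in_mat_of_rows_list_2 gate_ring_power root_simps)
  moreover have "entries_in (gate_ring \<omega>) gate_CZ"
    using basic carrier_matD [OF gate_CZ_carrier] by (auto simp: entries_in_def index_gate_CZ)
  moreover have "entries_in (gate_ring \<omega>) (\<omega> \<cdot>\<^sub>m 1\<^sub>m (2 ^ n))"
    using basic by (auto simp: entries_in_def)
  ultimately show ?case
    using gen unfolding clifford_gens_def on_qubit_def on_qubits_def
    by (auto intro!: kron_entries one_entries)
next
  case (adjoint U)
  then show ?case by (intro adjoint_entries)
next
  case (mult U W)
  then show ?case
    using clifford_carrier_mat [of U n] clifford_carrier_mat [of W n] by (intro mult_entries) auto
qed

text \<open>
  The Clifford group contains no phases beyond those put in by hand. The entry \<open>c\<close> lies in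
  \<^term>\<open>gate_ring \<omega>\<close> and has modulus 1.
\<close>

lemma scalar_clifford:
  assumes "c \<cdot>\<^sub>m 1\<^sub>m (2 ^ n) \<in> carrier (clifford \<omega> n)"
  obtains j where "c = \<omega> ^ j"
proof -
  have "c \<in> gate_ring \<omega>"
    using clifford_entries [OF assms, unfolded entries_in_def, rule_format, of 0 0] by simp
  moreover have "c * cnj c = 1"
    using clifford_unitary [OF assms] by (simp add: scalar_unitary_iff)
  ultimately show thesis
    using unit_modulus_in_gate_ring [OF root] that by blast
qed

lemma phase_gen_clifford: "\<omega> \<cdot>\<^sub>m 1\<^sub>m (2 ^ n) \<in> carrier (clifford \<omega> n)"
  by (rule clifford_gens_in_clifford) (simp add: clifford_gens_def)

lemma phases_eq: "phases \<omega> n = {\<omega> ^ j \<cdot>\<^sub>m 1\<^sub>m (2 ^ n) | j. True}"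
proof (intro equalityI subsetI)
  fix h assume "h \<in> phases \<omega> n"
  then have "h \<in> generate (clifford \<omega> n) {\<omega> \<cdot>\<^sub>m 1\<^sub>m (2 ^ n)}" by (simp add: phases_def)
  then have "\<exists>j. h = \<omega> ^ j \<cdot>\<^sub>m 1\<^sub>m (2 ^ n)"
  proof induction
    case one
    show ?case by (rule exI [of _ 0]) (auto intro: eq_matI)
  next
    case (incl h)
    then show ?case by (intro exI [of _ 1]) simp
  next
    case (inv h)
    have "\<omega> ^ 7 = \<omega> ^ 4 * \<omega> ^ 3" by (simp flip: power_add)
    then have "cnj \<omega> = \<omega> ^ 7" using root_simps(1,3) by simp
    then have "mat_adjoint (\<omega> \<cdot>\<^sub>m 1\<^sub>m (2 ^ n)) = \<omega> ^ 7 \<cdot>\<^sub>m 1\<^sub>m (2 ^ n)"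
      by (intro eq_matI) auto
    then show ?case using inv by (auto simp: inv_clifford phase_gen_clifford)
  next
    case (eng h1 h2)
    then obtain j k where "h1 = \<omega> ^ j \<cdot>\<^sub>m 1\<^sub>m (2 ^ n)" "h2 = \<omega> ^ k \<cdot>\<^sub>m 1\<^sub>m (2 ^ n)" by blast
    then have "h1 \<otimes>\<^bsub>clifford \<omega> n\<^esub> h2 = \<omega> ^ (j + k) \<cdot>\<^sub>m 1\<^sub>m (2 ^ n)"
      by (simp add: scalar_mult_mat smult_smult_mat power_add)
    then show ?case by blast
  qed
  then show "h \<in> {\<omega> ^ j \<cdot>\<^sub>m 1\<^sub>m (2 ^ n) | j. True}" by simp
next
  fix h assume "h \<in> {\<omega> ^ j \<cdot>\<^sub>m 1\<^sub>m (2 ^ n) | j. True}"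
  then obtain j where "h = \<omega> ^ j \<cdot>\<^sub>m 1\<^sub>m (2 ^ n)" by blast
  moreover have "\<omega> ^ j \<cdot>\<^sub>m 1\<^sub>m (2 ^ n) \<in> generate (clifford \<omega> n) {\<omega> \<cdot>\<^sub>m 1\<^sub>m (2 ^ n)}"
  proof (induction j)
    case 0
    have "\<omega> ^ 0 \<cdot>\<^sub>m 1\<^sub>m (2 ^ n) = \<one>\<^bsub>clifford \<omega> n\<^esub>" by (auto intro: eq_matI)
    then show ?case by (simp only: generate.one)
  next
    case (Suc j)
    have "\<omega> ^ Suc j \<cdot>\<^sub>m 1\<^sub>m (2 ^ n) = (\<omega> ^ j \<cdot>\<^sub>m 1\<^sub>m (2 ^ n)) \<otimes>\<^bsub>clifford \<omega> n\<^esub> (\<omega> \<cdot>\<^sub>m 1\<^sub>m (2 ^ n))"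
      by (simp add: scalar_mult_mat smult_smult_mat mult.commute)
    then show ?case using Suc generate.eng generate.incl by (metis insertI1)
  qed
  ultimately show "h \<in> phases \<omega> n" by (simp add: phases_def)
qed

lemma phases_normal: "phases \<omega> n \<lhd> clifford \<omega> n"
proof -
  have "subgroup (phases \<omega> n) (clifford \<omega> n)"
    unfolding phases_def using phase_gen_clifford
    by (intro group.generate_is_subgroup [OF group_clifford]) auto
  moreover have "phases \<omega> n #>\<^bsub>clifford \<omega> n\<^esub> U = U <#\<^bsub>clifford \<omega> n\<^esub> phases \<omega> n"
    if "U \<in> carrier (clifford \<omega> n)" for U
    using clifford_carrier_mat [OF that]
    by (force simp: r_coset_def l_coset_def phases_eq scalar_mult_mat)
  ultimately show ?thesis by (intro group.normalI [OF group_clifford]) auto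
qed

lemma phase_coset_eqD:
  assumes "U \<in> carrier (clifford \<omega> n)" "W \<in> carrier (clifford \<omega> n)"
    and "phases \<omega> n #>\<^bsub>clifford \<omega> n\<^esub> U = phases \<omega> n #>\<^bsub>clifford \<omega> n\<^esub> W"
  obtains j where "U = \<omega> ^ j \<cdot>\<^sub>m W"
proof -
  have "U \<in> phases \<omega> n #>\<^bsub>clifford \<omega> n\<^esub> W"
    using group.rcos_self [OF group_clifford assms(1) normal_imp_subgroup [OF phases_normal]] assms(3) by simp
  then show thesis
    using that clifford_carrier_mat [OF assms(2)] by (auto simp: r_coset_def phases_eq scalar_mult_mat)
qed

section \<open>The conjugacy class of the phase gate\<close>

text \<open>
  For a Hermitian \<open>P\<close> with \<open>P\<^sup>2 = 1\<close> this is the quarter-turn rotation with eigenvalue 1 on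
  the \<open>+1\<close> eigenspace of \<open>P\<close> and \<open>\<omega>\<^sup>2\<close> on the \<open>-1\<close> eigenspace; the phase gate is the case \<open>P = Z\<close>.
\<close>

definition rotation :: "nat \<Rightarrow> complex mat \<Rightarrow> complex mat" where
  "rotation n P = ((1 + \<omega>\<^sup>2) / 2) \<cdot>\<^sub>m 1\<^sub>m (2 ^ n) + ((1 - \<omega>\<^sup>2) / 2) \<cdot>\<^sub>m P"

lemma rotation_coeffs: "1 + \<omega>\<^sup>2 \<noteq> 0" "1 - \<omega>\<^sup>2 \<noteq> 0"
proof -
  have "(\<omega>\<^sup>2)\<^sup>2 \<noteq> 1" using root_simps(4) by simp
  then have "\<omega>\<^sup>2 \<noteq> 1" "\<omega>\<^sup>2 \<noteq> -1" by (auto simp only: power2_minus power_one simp_thms)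
  then show "1 + \<omega>\<^sup>2 \<noteq> 0" "1 - \<omega>\<^sup>2 \<noteq> 0" by (auto simp: add_eq_0_iff)
qed

lemma rotation_carrier: "P \<in> carrier_mat (2 ^ n) (2 ^ n) \<Longrightarrow> rotation n P \<in> carrier_mat (2 ^ n) (2 ^ n)"
  by (simp add: rotation_def)

text \<open>
  The identity part commutes with \<open>U\<close>, and the coefficient of \<open>P\<close> is nonzero, so rotations are conjugate
  in the same way as their axes.
\<close>

lemma rotation_intertwine:
  assumes U: "U \<in> carrier_mat (2 ^ n) (2 ^ n)" and P: "P \<in> carrier_mat (2 ^ n) (2 ^ n)"
    and Q: "Q \<in> carrier_mat (2 ^ n) (2 ^ n)"
  shows "U * rotation n P = rotation n Q * U \<longleftrightarrow> U * P = Q * U"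
proof -
  let ?a = "(1 + \<omega>\<^sup>2) / 2" and ?b = "(1 - \<omega>\<^sup>2) / 2"
  have "U * rotation n P = U * (?a \<cdot>\<^sub>m 1\<^sub>m (2 ^ n)) + U * (?b \<cdot>\<^sub>m P)"
    unfolding rotation_def using P by (intro mult_add_distrib_mat [OF U]) auto
  then have l: "U * rotation n P = ?a \<cdot>\<^sub>m U + ?b \<cdot>\<^sub>m (U * P)"
    using scalar_mult_mat(2) [OF U] mult_smult_distrib [OF U P] by simp
  have "rotation n Q * U = (?a \<cdot>\<^sub>m 1\<^sub>m (2 ^ n)) * U + (?b \<cdot>\<^sub>m Q) * U"
    unfolding rotation_def using Q by (intro add_mult_distrib_mat [OF _ _ U]) auto
  then have r: "rotation n Q * U = ?a \<cdot>\<^sub>m U + ?b \<cdot>\<^sub>m (Q * U)"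
    using scalar_mult_mat(1) [OF U] mult_smult_assoc_mat [OF Q U] by simp
  have "U * P = Q * U" if eq: "?a \<cdot>\<^sub>m U + ?b \<cdot>\<^sub>m (U * P) = ?a \<cdot>\<^sub>m U + ?b \<cdot>\<^sub>m (Q * U)"
  proof (rule eq_matI)
    fix i j assume "i < dim_row (Q * U)" "j < dim_col (Q * U)"
    then have "i < 2 ^ n" "j < 2 ^ n" using Q U by auto
    then have "?a * U $$ (i, j) + ?b * (U * P) $$ (i, j) = ?a * U $$ (i, j) + ?b * (Q * U) $$ (i, j)"
      using arg_cong [OF eq, of "\<lambda>M. M $$ (i, j)"] U P Q by (simp del: index_mult_mat(1))
    then show "(U * P) $$ (i, j) = (Q * U) $$ (i, j)"
      using rotation_coeffs by (simp del: index_mult_mat(1))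
  qed (use U P Q in auto)
  then show ?thesis unfolding l r by auto
qed

lemma rotation_inj:
  assumes "P \<in> carrier_mat (2 ^ n) (2 ^ n)" "Q \<in> carrier_mat (2 ^ n) (2 ^ n)" "rotation n P = rotation n Q"
  shows "P = Q"
proof -
  have "1\<^sub>m (2 ^ n) * rotation n P = rotation n Q * 1\<^sub>m (2 ^ n)"
    using assms(3) left_mult_one_mat [OF rotation_carrier [OF assms(2)]]
      right_mult_one_mat [OF rotation_carrier [OF assms(2)]] by simp
  then show ?thesis
    using rotation_intertwine [OF one_carrier_mat assms(1,2)] assms(1,2) by simp
qed

lemma trace_rotation:
  assumes "P \<in> signed_paulis n"
  shows "trace (rotation n P) = (1 + \<omega>\<^sup>2) / 2 * 2 ^ n"
  using signed_paulis_carrier [OF assms] trace_signed_pauli [OF assms]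
  by (simp add: rotation_def trace_add [where n = "2 ^ n"] trace_smult [where n = "2 ^ n"] trace_one)

text \<open>
  Both rotations have the same nonzero trace, because a nontrivial Pauli string has trace 0; this pins
  down the scalar.
\<close>

lemma rotation_phase_eqD:
  assumes P: "P \<in> signed_paulis n" and Q: "Q \<in> signed_paulis n" and eq: "rotation n P = c \<cdot>\<^sub>m rotation n Q"
  shows "P = Q" "c = 1"
proof -
  note PQ = signed_paulis_carrier [OF P] signed_paulis_carrier [OF Q]
  have "(1 + \<omega>\<^sup>2) / 2 * 2 ^ n = c * ((1 + \<omega>\<^sup>2) / 2 * 2 ^ n)"
    using arg_cong [OF eq, of trace] trace_smult [OF rotation_carrier [OF PQ(2)]]
    by (simp add: trace_rotation [OF P] trace_rotation [OF Q])
  then show "c = 1" using rotation_coeffs(1) by simp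
  moreover have "1 \<cdot>\<^sub>m rotation n Q = rotation n Q" by (auto intro: eq_matI)
  ultimately show "P = Q" using eq by (intro rotation_inj [OF PQ]) simp
qed

lemma phase_gate_eq_rotation:
  assumes "n \<ge> 1"
  shows "on_qubit n 1 (gate_S \<omega>) = rotation n (1 \<cdot>\<^sub>m pauli_op (PauliZ # replicate (n - 1) PauliI))"
proof -
  let ?a = "(1 + \<omega>\<^sup>2) / 2" and ?b = "(1 - \<omega>\<^sup>2) / 2"
  have "gate_S \<omega> = ?a \<cdot>\<^sub>m 1\<^sub>m 2 + ?b \<cdot>\<^sub>m pauli_gate (\<omega>\<^sup>2) PauliZ"
    by (rule eq_matI) (auto simp: gate_S_def mat_of_rows_list_2_index less_2_cases_iff field_simps)
  moreover have "?a \<cdot>\<^sub>m 1\<^sub>m 2 \<in> carrier_mat 2 2" "?b \<cdot>\<^sub>m pauli_gate (\<omega>\<^sup>2) PauliZ \<in> carrier_mat 2 2"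
    by auto
  ultimately have "gate_S \<omega> \<otimes>\<^sub>K 1\<^sub>m (2 ^ (n - 1))
      = ?a \<cdot>\<^sub>m (1\<^sub>m 2 \<otimes>\<^sub>K 1\<^sub>m (2 ^ (n - 1))) + ?b \<cdot>\<^sub>m (pauli_gate (\<omega>\<^sup>2) PauliZ \<otimes>\<^sub>K 1\<^sub>m (2 ^ (n - 1)))"
    by (simp only: kron_add_left kron_smult_left)
  moreover have "2 * 2 ^ (n - 1) = (2 ^ n :: nat)" using assms by (simp flip: power_Suc)
  moreover have "1 \<cdot>\<^sub>m M = M" for M :: "complex mat" by (auto intro: eq_matI)
  ultimately show ?thesis
    by (simp add: on_qubit_def rotation_def kron_one pauli_mat_identity del: One_nat_def pauli_gate.simps)
qed

lemma conjugate_by_clifford: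
  assumes "U \<in> carrier (clifford \<omega> n)" "P \<in> carrier_mat (2 ^ n) (2 ^ n)" "Q \<in> carrier_mat (2 ^ n) (2 ^ n)"
  shows "conjugate_by (clifford \<omega> n) U P = Q \<longleftrightarrow> U * P = Q * U"
proof -
  have U: "U \<in> carrier_mat (2 ^ n) (2 ^ n)" using assms(1) by (rule clifford_carrier_mat)
  have "conjugate_by (clifford \<omega> n) U P = U * P * mat_adjoint U"
    using assoc_mult_mat [OF U assms(2) mat_adjoint_carrier [OF U]]
    by (simp add: conjugate_by_def inv_clifford assms(1))
  then show ?thesis
    using unitary_intertwines_iff [OF clifford_unitary [OF assms(1)] assms(2,3)] by simp
qed

text \<open>
  One inclusion is invariance of the signed Paulis under Cliffords, the other is transitivity.
\<close>

lemma conjugacy_class_phase_gate: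
  assumes "n \<ge> 1"
  shows "conjugacy_class (clifford \<omega> n) (on_qubit n 1 (gate_S \<omega>)) = rotation n ` signed_paulis n"
proof -
  define Z where "Z = 1 \<cdot>\<^sub>m pauli_op (PauliZ # replicate (n - 1) PauliI)"
  have Z: "Z \<in> signed_paulis n"
    unfolding signed_paulis_iff Z_def using assms
    by (intro exI [of _ 1] exI [of _ "PauliZ # replicate (n - 1) PauliI"]) simp
  note Zc = signed_paulis_carrier [OF Z]
  have rot: "conjugate_by (clifford \<omega> n) U (rotation n Z) = rotation n Q \<longleftrightarrow> U * Z = Q * U"
    if "U \<in> carrier (clifford \<omega> n)" "Q \<in> carrier_mat (2 ^ n) (2 ^ n)" for U Q
    using conjugate_by_clifford [OF that(1) rotation_carrier [OF Zc] rotation_carrier [OF that(2)]]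
      rotation_intertwine [OF clifford_carrier_mat [OF that(1)] Zc that(2)] by simp
  show ?thesis
    unfolding phase_gate_eq_rotation [OF assms] Z_def [symmetric] conjugacy_class_def
  proof (intro equalityI subsetI)
    fix v assume "v \<in> {conjugate_by (clifford \<omega> n) U (rotation n Z) | U. U \<in> carrier (clifford \<omega> n)}"
    then obtain U where U: "U \<in> carrier (clifford \<omega> n)" "v = conjugate_by (clifford \<omega> n) U (rotation n Z)"
      by blast
    obtain Q where "Q \<in> signed_paulis n" "U * Z = Q * U"
      using clifford_maps_signed_paulis [OF U(1) Z] by blast
    then show "v \<in> rotation n ` signed_paulis n"
      using rot [OF U(1)] U(2) signed_paulis_carrier by blast
  next
    fix v assume "v \<in> rotation n ` signed_paulis n"
    then obtain Q where Q: "Q \<in> signed_paulis n" "v = rotation n Q" by blast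
    obtain U where "U \<in> carrier (clifford \<omega> n)" "U * Z = Q * U"
      using clifford_transitive [OF Q(1) assms] unfolding Z_def [symmetric] clifford_conj_def by blast
    then show "v \<in> {conjugate_by (clifford \<omega> n) U (rotation n Z) | U. U \<in> carrier (clifford \<omega> n)}"
      using rot signed_paulis_carrier [OF Q(1)] Q(2) by force
  qed
qed

lemma rotation_in_clifford:
  assumes "n \<ge> 1" "P \<in> signed_paulis n"
  shows "rotation n P \<in> carrier (clifford \<omega> n)"
proof -
  have "on_qubit n 1 (gate_S \<omega>) \<in> carrier (clifford \<omega> n)"
    using assms by (intro clifford_gens_in_clifford) (auto simp: clifford_gens_def)
  from group.conjugacy_class_subset [OF group_clifford this] show ?thesis
    unfolding conjugacy_class_phase_gate [OF assms(1)] using assms(2) by blast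
qed

lemma commutes_with_signed_paulis:
  assumes U: "U \<in> carrier (clifford \<omega> n)" and comm: "\<And>P. P \<in> signed_paulis n \<Longrightarrow> U * P = P * U"
  shows "U \<in> phases \<omega> n"
proof -
  have c: "U \<in> carrier_mat (2 ^ n) (2 ^ n)" using U by (rule clifford_carrier_mat)
  have "U * pauli_op p = pauli_op p * U" if "length p = n" for p
  proof (cases "p = replicate n PauliI")
    case True
    then show ?thesis using c by (simp add: pauli_mat_identity)
  next
    case False
    then have "1 \<cdot>\<^sub>m pauli_op p \<in> signed_paulis n"
      using that unfolding signed_paulis_def by blast
    moreover have "1 \<cdot>\<^sub>m pauli_op p = pauli_op p" by (auto intro: eq_matI)
    ultimately show ?thesis using comm by metis
  qed
  then obtain d where d: "U = d \<cdot>\<^sub>m 1\<^sub>m (2 ^ n)"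
    using commutes_with_paulis_imp_scalar [OF root_simps(4) c] by blast
  then obtain j where "d = \<omega> ^ j" using scalar_clifford U by blast
  then show ?thesis using d by (auto simp: phases_eq)
qed

end

theorem theorem6p4:
  fixes \<omega> :: complex and n :: nat
  assumes "primitive_root_of_unity 8 \<omega>" and "n \<ge> 1"
  shows "let C = proj_clifford \<omega> n; V = conjugacy_class C (s_class \<omega> n 1) in
           conjugation_perm C V \<in> hom C (symmetric_group V)
           \<and> inj_on (conjugation_perm C V) (carrier C)
           \<and> card V = 2 * (4 ^ n - 1)"
proof -
  interpret eighth_root \<omega> by unfold_locales (rule assms(1))
  define G where "G = clifford \<omega> n"
  define H where "H = phases \<omega> n"
  define V where "V = conjugacy_class (G Mod H) (s_class \<omega> n 1)"
  interpret normal H G unfolding G_def H_def by (rule phases_normal)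
  interpret C: group "G Mod H" by (rule factorgroup_is_group)
  have S: "on_qubit n 1 (gate_S \<omega>) \<in> carrier G"
    unfolding G_def using assms(2) by (intro clifford_gens_in_clifford) (auto simp: clifford_gens_def)
  have V_eq: "V = (\<lambda>P. H #>\<^bsub>G\<^esub> rotation n P) ` signed_paulis n"
    using conjugacy_class_coset [OF S] conjugacy_class_phase_gate [OF assms(2)]
    by (simp add: V_def s_class_def proj_class_def G_def H_def image_image)
  have rot: "rotation n P \<in> carrier G" if "P \<in> signed_paulis n" for P
    unfolding G_def using assms(2) that by (rule rotation_in_clifford)
  have s: "s_class \<omega> n 1 \<in> carrier (G Mod H)"
    using S by (auto simp: carrier_FactGroup s_class_def proj_class_def G_def H_def)
  have V_carrier: "V \<subseteq> carrier (G Mod H)"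
    unfolding V_def by (rule C.conjugacy_class_subset [OF s])
  have "conjugation_perm (G Mod H) V \<in> hom (G Mod H) (symmetric_group V)"
    using V_carrier C.conjugate_by_conjugacy_class [OF s]
    by (intro C.conjugation_perm_hom) (auto simp: V_def)
  moreover have "inj_on (conjugation_perm (G Mod H) V) (carrier (G Mod H))"
  proof (rule C.conjugation_perm_inj [OF V_carrier])
    fix g
    assume "g \<in> carrier (G Mod H)"
      and comm: "\<And>v. v \<in> V \<Longrightarrow> v \<otimes>\<^bsub>G Mod H\<^esub> g = g \<otimes>\<^bsub>G Mod H\<^esub> v"
    then obtain U where U: "U \<in> carrier G" and g: "g = H #>\<^bsub>G\<^esub> U"
      by (auto simp: carrier_FactGroup)
    note cU = clifford_carrier_mat [OF U [unfolded G_def]]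
    have "U * P = P * U" if P: "P \<in> signed_paulis n" for P
    proof -
      let ?R = "rotation n P"
      note cP = signed_paulis_carrier [OF P]
      have "H #>\<^bsub>G\<^esub> (?R \<otimes>\<^bsub>G\<^esub> U) = H #>\<^bsub>G\<^esub> (U \<otimes>\<^bsub>G\<^esub> ?R)"
        using comm [of "H #>\<^bsub>G\<^esub> ?R"] P U rot by (simp add: g V_eq rcos_sum)
      then obtain j where j: "U * ?R = \<omega> ^ j \<cdot>\<^sub>m (?R * U)"
        using phase_coset_eqD [of "?R \<otimes>\<^bsub>G\<^esub> U" n "U \<otimes>\<^bsub>G\<^esub> ?R"] m_closed U rot [OF P]
        by (auto simp: G_def H_def)
      obtain Q where Q: "Q \<in> signed_paulis n" "U * P = Q * U"
        using clifford_maps_signed_paulis [OF _ P] U unfolding G_def by blast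
      note cQ = signed_paulis_carrier [OF Q(1)]
      have "rotation n Q * U = (\<omega> ^ j \<cdot>\<^sub>m ?R) * U"
        using j Q(2) rotation_intertwine [OF cU cP cQ] mult_smult_assoc_mat [OF rotation_carrier [OF cP] cU]
        by simp
      then have "rotation n Q = \<omega> ^ j \<cdot>\<^sub>m ?R"
        by (rule unitary_right_cancel [OF clifford_unitary [OF U [unfolded G_def]]
              rotation_carrier [OF cQ] smult_carrier_mat [OF rotation_carrier [OF cP]]])
      \<comment> \<open>Up to a phase, the rotation about \<open>P\<close> is conjugated to itself; comparing traces, \<open>U\<close> fixes its axis.\<close>
      then have "Q = P" by (rule rotation_phase_eqD [OF Q(1) P])
      with Q(2) show ?thesis by simp
    qed
    then have "U \<in> H"
      using commutes_with_signed_paulis U unfolding G_def H_def by blast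
    then show "g = \<one>\<^bsub>G Mod H\<^esub>"
      by (simp add: g rcos_const)
  qed
  moreover have "card V = 2 * (4 ^ n - 1)"
  proof -
    have "inj_on (\<lambda>P. H #>\<^bsub>G\<^esub> rotation n P) (signed_paulis n)"
    proof (rule inj_onI)
      fix P Q
      assume PQ: "P \<in> signed_paulis n" "Q \<in> signed_paulis n"
        and "H #>\<^bsub>G\<^esub> rotation n P = H #>\<^bsub>G\<^esub> rotation n Q"
      then obtain j where "rotation n P = \<omega> ^ j \<cdot>\<^sub>m rotation n Q"
        using phase_coset_eqD rot unfolding G_def H_def by metis
      then show "P = Q" by (rule rotation_phase_eqD [OF PQ])
    qed
    then show ?thesis by (simp add: V_eq card_image card_signed_paulis)
  qed
  ultimately show ?thesis
    by (simp add: proj_clifford_def V_def G_def H_def Let_def)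
qed

end
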